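(* Let $L$ be the set of all $e \in \mathbb{N}$ such that $\varphi_e$ is an effective concept class. The set of $e \in L$ such that $\varphi_e$ has infinite VC dimension is $m$-complete $\Pi^0_3$ within $L$, and the set of $e \in L$ such that $\varphi_e$ has finite VC dimension is $\Sigma^0_3$ within $L$.
   Context: $\varphi_e$ denotes the $e$-th partial computable function. A $\Pi^0_1$ tree is a co-computably-enumerable subtree of $2^{<\omega}$; a $\Pi^0_1$ index for it is an index of a Turing machine enumerating its complement. A weakly effective concept class is a total computable function $\varphi_e : \mathbb{N} \to \mathbb{N}$ such that each $\varphi_e(n)$ is a $\Pi^0_1$ index for a $\Pi^0_1$ tree $T_{e,n}$; its concepts are the sets $c_n \subseteq 2^\omega$ of infinite paths through $T_{e,n}$, and the class is $\mathcal{C} = \{c_n : n\in\mathbb{N}\}$. An effective concept class is a weakly effective concept class such that for each $n$ there is a computable function $f_{c_n} : 2^{<\omega} \times \mathbb{Q} \to \{0,1\}$ with $f_{c_n}(\sigma, r) = 1$ if $B_r(\sigma) \cap c_n \neq \emptyset$, $f_{c_n}(\sigma,r) = 0$ if $B_{2r}(\sigma) \cap c_n = \emptyset$, and arbitrary in $\{0,1\}$ otherwise; here $B_r(\sigma)$ is the set of all $x \in 2^\omega$ that either extend $\sigma$ or first differ from $\sigma$ at the $(-\lceil \log_2 r\rceil)$-th place or later. For $S \subseteq 2^\omega$, $\Pi_{\mathcal{C}}(S) = |\{S \cap c : c \in \mathcal{C}\}|$; the VC dimension of $\mathcal{C}$ is the greatest integer $d$ such that $\Pi_{\mathcal{C}}(S)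 = 2^d$ for some $S$ of cardinality $d$, if it exists, and $\infty$ otherwise. For $A \subseteq B \subseteq \mathbb{N}$ and a class $\Gamma$ of sets: $A$ is $\Gamma$ within $B$ if $A = R \cap B$ for some $R \in \Gamma$; $S \leq_m A$ within $B$ if there is a computable $f : \mathbb{N} \to B$ with $n \in S \Leftrightarrow f(n) \in A$ for all $n$; $A$ is $m$-complete $\Gamma$ within $B$ if $A$ is $\Gamma$ within $B$ and $S \leq_m A$ within $B$ for every $S \in \Gamma$. *)

theory Defs
  imports Complex_Main "HOL-Library.Nat_Bijection" "HOL-Library.Extended_Nat"
begin

section \<open>Partial computable functions\<close>

text \<open>
  Kleene's partial recursive functions in unary form: several arguments are passed through the
  Cantor pairing function \<^const>\<open>prod_encode\<close>, so that \<open>Fst\<close> and \<open>Snd\<close> play the role of the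
  projections and \<open>Pair Fst Snd\<close> is the identity.
\<close>

datatype prog =
    Zero | Succ | Fst | Snd
  | Pair prog prog | Comp prog prog | Prec prog prog | Mu prog

primrec eval :: "prog \<Rightarrow> nat \<Rightarrow> nat option" where
  "eval Zero = (\<lambda>x. Some 0)"
| "eval Succ = (\<lambda>x. Some (Suc x))"
| "eval Fst = (\<lambda>x. Some (fst (prod_decode x)))"
| "eval Snd = (\<lambda>x. Some (snd (prod_decode x)))"
| "eval (Pair p q) =
     (\<lambda>x. Option.bind (eval p x) (\<lambda>a. Option.bind (eval q x) (\<lambda>b. Some (prod_encode (a, b)))))"
| "eval (Comp p q) = (\<lambda>x. Option.bind (eval q x) (eval p))"
| "eval (Prec p q) =
     (\<lambda>x. rec_nat (eval p (fst (prod_decode x)))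
        (\<lambda>k r. Option.bind r
           (\<lambda>v. eval q (prod_encode (fst (prod_decode x), prod_encode (k, v)))))
        (snd (prod_decode x)))"
| "eval (Mu p) =
     (\<lambda>x. if \<exists>n. eval p (prod_encode (x, n)) = Some 0 \<and>
               (\<forall>m<n. \<exists>v. eval p (prod_encode (x, m)) = Some (Suc v))
          then Some (LEAST n. eval p (prod_encode (x, n)) = Some 0) else None)"

primrec prog_encode :: "prog \<Rightarrow> nat" where
  "prog_encode Zero = 0"
| "prog_encode Succ = 1"
| "prog_encode Fst = 2"
| "prog_encode Snd = 3"
| "prog_encode (Pair p q) = 4 * prod_encode (prog_encode p, prog_encode q) + 4"
| "prog_encode (Comp p q) = 4 * prod_encode (prog_encode p, prog_encode q) + 5"
| "prog_encode (Prec p q) = 4 * prod_encode (prog_encode p, prog_encode q) + 6"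
| "prog_encode (Mu p) = 4 * prog_encode p + 7"

lemma prog_encode_inject: "prog_encode p = prog_encode q \<Longrightarrow> p = q"
proof (induction p arbitrary: q)
  case Zero then show ?case by (cases q) auto
next
  case Succ then show ?case by (cases q) auto
next
  case Fst then show ?case by (cases q) auto
next
  case Snd then show ?case by (cases q) auto
next
  case (Pair p1 p2) from Pair.prems Pair.IH show ?case
    by (cases q; simp; (presburger | (metis Pair_inject prod_encode_eq)))
next
  case (Comp p1 p2) from Comp.prems Comp.IH show ?case
    by (cases q; simp; (presburger | (metis Pair_inject prod_encode_eq)))
next
  case (Prec p1 p2) from Prec.prems Prec.IH show ?case
    by (cases q; simp; (presburger | (metis Pair_inject prod_encode_eq)))
next
  case (Mu p) from Mu.prems Mu.IH show ?case
    by (cases q; simp; presburger)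
qed

lemma prog_encode_surj: "\<exists>p. prog_encode p = n"
proof (induction n rule: less_induct)
  case (less n)
  show ?case
  proof (cases "n < 4")
    case True
    then have "n = 0 \<or> n = 1 \<or> n = 2 \<or> n = 3" by auto
    then show ?thesis
      using prog_encode.simps(1-4) by metis
  next
    case False
    define m where "m = (n - 4) div 4"
    have n: "n = 4 * m + 4 \<or> n = 4 * m + 5 \<or> n = 4 * m + 6 \<or> n = 4 * m + 7"
      using False unfolding m_def by presburger
    obtain a b where ab: "m = prod_encode (a, b)"
      by (metis prod_decode_inverse surj_pair)
    have "a \<le> m" "b \<le> m" unfolding ab by (simp_all add: le_prod_encode_1 le_prod_encode_2)
    moreover have "m < n" using n by auto
    ultimately have "a < n" "b < n" by auto
    then obtain p q r where "prog_encode p = a" "prog_encode q = b" "prog_encode r = m"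
      using less.IH \<open>m < n\<close> by metis
    then show ?thesis
      using n ab prog_encode.simps(5-8) by metis
  qed
qed

lemma bij_prog_encode: "bij prog_encode"
  unfolding bij_def inj_def surj_def using prog_encode_inject prog_encode_surj by metis

definition phi :: "nat \<Rightarrow> nat \<Rightarrow> nat option" where
  "phi e = eval (inv prog_encode e)"

definition computable :: "(nat \<Rightarrow> nat) \<Rightarrow> bool" where
  "computable f \<longleftrightarrow> (\<exists>e. \<forall>x. phi e x = Some (f x))"


section \<open>Arithmetical hierarchy and relativised many-one completeness\<close>

primrec Sigma0 :: "nat \<Rightarrow> nat set set" where
  "Sigma0 0 = {A. computable (\<lambda>x. of_bool (x \<in> A))}"
| "Sigma0 (Suc n) = {A. \<exists>B. - B \<in> Sigma0 n \<and> A = {x. \<exists>y. prod_encode (x, y) \<in> B}}"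

definition Pi0 :: "nat \<Rightarrow> nat set set" where
  "Pi0 n = {A. - A \<in> Sigma0 n}"

definition in_class_within :: "nat set set \<Rightarrow> nat set \<Rightarrow> nat set \<Rightarrow> bool" where
  "in_class_within \<Gamma> A B \<longleftrightarrow> (\<exists>R\<in>\<Gamma>. A = R \<inter> B)"

definition m_reducible_within :: "nat set \<Rightarrow> nat set \<Rightarrow> nat set \<Rightarrow> bool" where
  "m_reducible_within S A B \<longleftrightarrow>
     (\<exists>f. computable f \<and> range f \<subseteq> B \<and> (\<forall>n. n \<in> S \<longleftrightarrow> f n \<in> A))"

definition m_complete_within :: "nat set set \<Rightarrow> nat set \<Rightarrow> nat set \<Rightarrow> bool" where
  "m_complete_within \<Gamma> A B \<longleftrightarrow>
     in_class_within \<Gamma> A B \<and> (\<forall>S\<in>\<Gamma>. m_reducible_within S A B)"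


section \<open>Trees and concept classes\<close>

text \<open>Bijective base-2 numeration, a computable bijection between binary strings and numbers.\<close>

primrec string_encode :: "bool list \<Rightarrow> nat" where
  "string_encode [] = 0"
| "string_encode (b # \<sigma>) = 2 * string_encode \<sigma> + (if b then 2 else 1)"

lemma bij_string_encode: "bij string_encode"
proof (rule bijI)
  have "string_encode \<sigma> = string_encode \<tau> \<Longrightarrow> \<sigma> = \<tau>" for \<sigma> \<tau>
  proof (induction \<sigma> arbitrary: \<tau>)
    case Nil then show ?case by (cases \<tau>) (auto split: if_splits)
  next
    case (Cons b \<sigma>)
    then obtain c \<rho> where \<tau>: "\<tau> = c # \<rho>" by (cases \<tau>) (auto split: if_splits)
    have "b = c \<and> string_encode \<sigma> = string_encode \<rho>"
      using Cons.prems unfolding \<tau> by (simp split: if_splits; presburger)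
    then show ?case using Cons.IH \<tau> by auto
  qed
  then show "inj string_encode" by (rule injI)
  have "\<exists>\<sigma>. n = string_encode \<sigma>" for n
  proof (induction n rule: less_induct)
    case (less n)
    show ?case
    proof (cases "n = 0")
      case True then show ?thesis by (intro exI[of _ "[]"]) simp
    next
      case False
      then have "(n - 1) div 2 < n" by auto
      then obtain \<sigma> where "(n - 1) div 2 = string_encode \<sigma>" using less by blast
      then show ?thesis using False
        by (intro exI[of _ "even n # \<sigma>"]) (simp; presburger)
    qed
  qed
  then show "surj string_encode" unfolding surj_def by blast
qed

definition rat_encode :: "rat \<Rightarrow> nat" where
  "rat_encode r = prod_encode (int_encode (fst (quotient_of r)), int_encode (snd (quotient_of r)))"

definition is_tree :: "bool list set \<Rightarrow> bool" where
  "is_tree T \<longleftrightarrow> (\<forall>\<sigma> \<tau>. \<sigma> @ \<tau> \<in> T \<longrightarrow> \<sigma> \<in> T)"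

definition paths :: "bool list set \<Rightarrow> (nat \<Rightarrow> bool) set" where
  "paths T = {x. \<forall>n. map x [0..<n] \<in> T}"

text \<open>
  The machine with index \<open>i\<close> enumerates the set \<open>ran (phi i)\<close> of its outputs. (The function
  \<open>phi i\<close> may be partial, so that the empty set can be enumerated.)
\<close>

definition pi01_index :: "nat \<Rightarrow> bool list set \<Rightarrow> bool" where
  "pi01_index i T \<longleftrightarrow> is_tree T \<and> string_encode ` (- T) = ran (phi i)"

definition tree_at :: "nat \<Rightarrow> nat \<Rightarrow> bool list set" where
  "tree_at e n = (THE T. pi01_index (the (phi e n)) T)"

lemma pi01_index_unique: "pi01_index i T \<Longrightarrow> pi01_index i T' \<Longrightarrow> T = T'"
  unfolding pi01_index_def
  by (metis bij_string_encode bij_is_inj inj_image_eq_iff double_compl)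

definition concept_at :: "nat \<Rightarrow> nat \<Rightarrow> (nat \<Rightarrow> bool) set" where
  "concept_at e n = paths (tree_at e n)"

definition concept_class :: "nat \<Rightarrow> (nat \<Rightarrow> bool) set set" where
  "concept_class e = range (concept_at e)"

definition weakly_effective_class :: "nat \<Rightarrow> bool" where
  "weakly_effective_class e \<longleftrightarrow> (\<forall>n. \<exists>i. phi e n = Some i \<and> (\<exists>T. pi01_index i T))"

text \<open>Places are counted from 0. The formula is meaningful for \<open>r > 0\<close> only.\<close>

definition cantor_ball :: "rat \<Rightarrow> bool list \<Rightarrow> (nat \<Rightarrow> bool) set" where
  "cantor_ball r \<sigma> = {x.
     (\<forall>i<length \<sigma>. x i = \<sigma> ! i) \<or>
     (\<exists>j<length \<sigma>. x j \<noteq> \<sigma> ! j \<and> (\<forall>i<j. x i = \<sigma> ! i) \<and> - \<lceil>log 2 (of_rat r)\<rceil> \<le> int j)}"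

definition effective_concept :: "(nat \<Rightarrow> bool) set \<Rightarrow> bool" where
  "effective_concept c \<longleftrightarrow>
     (\<exists>f :: bool list \<Rightarrow> rat \<Rightarrow> nat.
        (\<exists>e. \<forall>\<sigma> r. phi e (prod_encode (string_encode \<sigma>, rat_encode r)) = Some (f \<sigma> r)) \<and>
        (\<forall>\<sigma> r. f \<sigma> r \<in> {0, 1}) \<and>
        (\<forall>\<sigma> r. r > 0 \<longrightarrow>
           (cantor_ball r \<sigma> \<inter> c \<noteq> {} \<longrightarrow> f \<sigma> r = 1) \<and>
           (cantor_ball (2 * r) \<sigma> \<inter> c = {} \<longrightarrow> f \<sigma> r = 0)))"

definition effective_class :: "nat \<Rightarrow> bool" where
  "effective_class e \<longleftrightarrow>
     weakly_effective_class e \<and> (\<forall>n. effective_concept (concept_at e n))"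


section \<open>VC dimension\<close>

definition growth :: "'a set set \<Rightarrow> 'a set \<Rightarrow> nat" where
  "growth C S = card {S \<inter> c | c. c \<in> C}"

definition shatters_size :: "'a set set \<Rightarrow> nat \<Rightarrow> bool" where
  "shatters_size C d \<longleftrightarrow> (\<exists>S. finite S \<and> card S = d \<and> growth C S = 2 ^ d)"

definition vc_dim :: "'a set set \<Rightarrow> enat" where
  "vc_dim C =
     (if \<exists>d. shatters_size C d \<and> (\<forall>d'. shatters_size C d' \<longrightarrow> d' \<le> d)
      then enat (GREATEST d. shatters_size C d) else \<infinity>)"

end

theory Submission
  imports Defs
begin

text \<open>
  By compactness, ``there are points which are shattered by finitely many given concepts'' says that for some
  initial segments, already excluded from the trees that must omit them, the remaining trees have
  arbitrarily long common nodes. This is a \<open>\<Sigma>\<^sub>2\<close> condition, and infinite VC dimension asks for it in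
  every size. The only uniformity needed is a universal machine.

  For the hardness, let \<open>x \<in> S\<close> iff \<open>\<forall>a. \<exists>b. \<forall>c. Q (x, a, b, c)\<close> with \<open>Q\<close> decidable. A concept is indexed by a
  finite set with code \<open>A\<close> and a list \<open>w\<close> of candidate witnesses \<open>b\<close> for all \<open>a \<le> A\<close>. It cuts out \<open>A\<close> from
  a fixed infinite set of points until some candidate is refuted, and then becomes empty. If \<open>x \<in> S\<close>,
  every finite set is cut out; otherwise only finitely many \<open>A\<close> survive and the class is finite.
\<close>

section \<open>Computable functions\<close>

abbreviation pr :: "nat \<Rightarrow> nat \<Rightarrow> nat" where
  "pr a b \<equiv> prod_encode (a, b)"

definition pfst :: "nat \<Rightarrow> nat" where "pfst x = fst (prod_decode x)"
definition psnd :: "nat \<Rightarrow> nat" where "psnd x = snd (prod_decode x)"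

lemma pfst_pr [simp]: "pfst (pr a b) = a" by (simp add: pfst_def)
lemma psnd_pr [simp]: "psnd (pr a b) = b" by (simp add: psnd_def)
lemma pr_collapse [simp]: "pr (pfst x) (psnd x) = x" by (simp add: pfst_def psnd_def)

lemma phi_prog_encode [simp]: "phi (prog_encode p) = eval p"
  by (simp add: phi_def bij_prog_encode bij_is_inj)

lemma computable_iff: "computable f \<longleftrightarrow> (\<exists>p. \<forall>x. eval p x = Some (f x))"
  unfolding computable_def by (metis phi_prog_encode prog_encode_surj)

text \<open>The closure rules collected here take their arguments as functions of one common input,
  so \<open>intro comp\<close> follows the syntax of a term and leaves only its atoms.\<close>

named_theorems comp

lemma computable_id [comp]: "computable (\<lambda>x. x)"
  unfolding computable_iff by (rule exI[of _ "Pair Fst Snd"]) simp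

lemma computable_compose: "computable f \<Longrightarrow> computable g \<Longrightarrow> computable (\<lambda>x. f (g x))"
  unfolding computable_iff
proof (elim exE)
  fix p q assume "\<forall>x. eval p x = Some (f x)" "\<forall>x. eval q x = Some (g x)"
  then show "\<exists>p. \<forall>x. eval p x = Some (f (g x))" by (intro exI[of _ "Comp p q"]) simp
qed

lemma computable_pair [comp]: "computable f \<Longrightarrow> computable g \<Longrightarrow> computable (\<lambda>x. pr (f x) (g x))"
  unfolding computable_iff
proof (elim exE)
  fix p q assume "\<forall>x. eval p x = Some (f x)" "\<forall>x. eval q x = Some (g x)"
  then show "\<exists>p. \<forall>x. eval p x = Some (pr (f x) (g x))" by (intro exI[of _ "Pair p q"]) simp
qed

lemma computable_pfst [comp]: "computable f \<Longrightarrow> computable (\<lambda>x. pfst (f x))"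
  by (rule computable_compose) (auto simp: computable_iff pfst_def intro: exI[of _ Fst])

lemma computable_psnd [comp]: "computable f \<Longrightarrow> computable (\<lambda>x. psnd (f x))"
  by (rule computable_compose) (auto simp: computable_iff psnd_def intro: exI[of _ Snd])

lemma computable_Suc [comp]: "computable f \<Longrightarrow> computable (\<lambda>x. Suc (f x))"
  by (rule computable_compose) (auto simp: computable_iff intro: exI[of _ Succ])

lemma computable_const [comp]: "computable (\<lambda>x. c)"
proof (induction c)
  case 0
  show ?case by (auto simp: computable_iff intro: exI[of _ Zero])
qed (rule computable_Suc)

text \<open>\<open>Prec\<close> carries its parameter along, so the step function may depend on the
  input \<open>x\<close>; running it on \<open>pr x (n x)\<close> lets the number of rounds depend
  on \<open>x\<close> as well.\<close>

lemma computable_rec_nat [comp]: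
  assumes f: "computable f" and n: "computable n"
    and g: "computable (\<lambda>z. g (pfst z) (pfst (psnd z)) (psnd (psnd z)))"
  shows "computable (\<lambda>x. rec_nat (f x) (g x) (n x))"
proof -
  obtain p q where p: "\<And>x. eval p x = Some (f x)"
    and q: "\<And>z. eval q z = Some (g (pfst z) (pfst (psnd z)) (psnd (psnd z)))"
    using f g unfolding computable_iff by blast
  have "eval (Prec p q) (pr x k) = Some (rec_nat (f x) (g x) k)" for x k
    by (induction k) (simp_all add: p q)
  then have "computable (\<lambda>z. rec_nat (f (pfst z)) (g (pfst z)) (psnd z))"
    unfolding computable_iff by (metis pr_collapse)
  from computable_compose[OF this computable_pair[OF computable_id n]] show ?thesis by simp
qed

lemma computable_pred [comp]: "computable f \<Longrightarrow> computable (\<lambda>x. f x - 1)"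
proof -
  have "computable (\<lambda>x. rec_nat 0 (\<lambda>k v. k) x)" by (intro comp)
  moreover have "rec_nat 0 (\<lambda>k v. k) x = x - 1" for x :: nat by (cases x) auto
  ultimately show "computable f \<Longrightarrow> ?thesis" using computable_compose by simp
qed

lemma computable_add [comp]: "computable f \<Longrightarrow> computable g \<Longrightarrow> computable (\<lambda>x. f x + g x)"
proof -
  have "rec_nat m (\<lambda>k. Suc) n = m + n" for m n by (induction n) auto
  then show "computable f \<Longrightarrow> computable g \<Longrightarrow> ?thesis"
    using computable_rec_nat[of f g "\<lambda>_ _. Suc"] by (simp add: comp)
qed

lemma computable_diff [comp]: "computable f \<Longrightarrow> computable g \<Longrightarrow> computable (\<lambda>x. f x - g x)"
proof -
  have "rec_nat m (\<lambda>k v. v - 1) n = m - n" for m n by (induction n) auto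
  then show "computable f \<Longrightarrow> computable g \<Longrightarrow> ?thesis"
    using computable_rec_nat[of f g "\<lambda>_ _ v. v - 1"] computable_pred by (simp add: comp)
qed

lemma computable_mult [comp]: "computable f \<Longrightarrow> computable g \<Longrightarrow> computable (\<lambda>x. f x * g x)"
proof -
  have "rec_nat 0 (\<lambda>k v. v + m) n = m * n" for m n :: nat by (induction n) auto
  then show "computable f \<Longrightarrow> computable g \<Longrightarrow> ?thesis"
    using computable_rec_nat[of "\<lambda>_. 0" g "\<lambda>x _ v. v + f x"]
      computable_compose[of f pfst, OF _ computable_pfst[OF computable_id]]
    by (simp add: comp)
qed

lemma computable_pow2 [comp]: "computable f \<Longrightarrow> computable (\<lambda>x. (2::nat) ^ f x)"
proof -
  have "rec_nat 1 (\<lambda>k v. v + v) n = (2::nat) ^ n" for n :: nat by (induction n) auto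
  then show "computable f \<Longrightarrow> ?thesis"
    using computable_rec_nat[of "\<lambda>_. 1" f "\<lambda>_ _ v. v + v"] by (simp add: comp)
qed

section \<open>Decidable predicates and bounded quantification\<close>

definition decidable :: "(nat \<Rightarrow> bool) \<Rightarrow> bool" where
  "decidable P \<longleftrightarrow> computable (\<lambda>x. of_bool (P x))"

lemma computable_if [comp]:
  assumes "decidable P" "computable f" "computable g"
  shows "computable (\<lambda>x. if P x then f x else g x)"
proof -
  have "computable (\<lambda>x. of_bool (P x) * f x + (1 - of_bool (P x)) * g x)"
    using assms unfolding decidable_def by (intro comp)
  moreover have "of_bool (P x) * f x + (1 - of_bool (P x)) * g x = (if P x then f x else g x)" for x
    by simp
  ultimately show ?thesis by simp
qed

lemma decidable_eq_0: "computable f \<Longrightarrow> decidable (\<lambda>x. f x = 0)"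
proof -
  have "(of_bool (n = 0) :: nat) = 1 - n" for n :: nat by simp
  then show "computable f \<Longrightarrow> ?thesis" unfolding decidable_def by (simp only:) (intro comp)
qed

lemma decidable_not [comp]: "decidable P \<Longrightarrow> decidable (\<lambda>x. \<not> P x)"
  using decidable_eq_0[of "\<lambda>x. of_bool (P x)"] unfolding decidable_def by simp

lemma decidable_conj [comp]:
  assumes "decidable P" "decidable Q" shows "decidable (\<lambda>x. P x \<and> Q x)"
proof -
  have "(of_bool (P x \<and> Q x) :: nat) = of_bool (P x) * of_bool (Q x)" for x by simp
  then show ?thesis using assms unfolding decidable_def by (simp only:) (intro comp)
qed

lemma decidable_disj [comp]: "decidable P \<Longrightarrow> decidable Q \<Longrightarrow> decidable (\<lambda>x. P x \<or> Q x)"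
  using decidable_not[OF decidable_conj[OF decidable_not decidable_not], of P Q] by simp

lemma decidable_imp [comp]: "decidable P \<Longrightarrow> decidable Q \<Longrightarrow> decidable (\<lambda>x. P x \<longrightarrow> Q x)"
  unfolding imp_conv_disj by (intro decidable_disj decidable_not)

lemma decidable_le [comp]: "computable f \<Longrightarrow> computable g \<Longrightarrow> decidable (\<lambda>x. f x \<le> g x)"
  using decidable_eq_0[of "\<lambda>x. f x - g x"] by (simp add: comp)

lemma decidable_less [comp]: "computable f \<Longrightarrow> computable g \<Longrightarrow> decidable (\<lambda>x. f x < g x)"
  using decidable_not[OF decidable_le[of g f]] by (simp add: not_le)

lemma decidable_eq [comp]: "computable f \<Longrightarrow> computable g \<Longrightarrow> decidable (\<lambda>x. f x = g x)"
  unfolding order_eq_iff by (intro decidable_conj decidable_le)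

lemma decidable_bex [comp]:
  assumes "computable n" "decidable (\<lambda>z. P (pfst z) (psnd z))"
  shows "decidable (\<lambda>x. \<exists>y<n x. P x y)"
proof -
  have rec: "(of_bool (\<exists>y<k. P x y) :: nat) = rec_nat 0 (\<lambda>y v. if P x y then Suc 0 else v) k" for x k
  proof (induction k)
    case (Suc k)
    then show ?case by (cases "P x k") (simp_all add: Ex_less_Suc)
  qed simp
  \<comment> \<open>The recursion step receives input, counter and previous value; the test
    \<open>P\<close> reads only the first two.\<close>
  have "computable (\<lambda>z. of_bool (P (pfst z) (pfst (psnd z))))"
    using computable_compose[of "\<lambda>z. of_bool (P (pfst z) (psnd z))" "\<lambda>z. pr (pfst z) (pfst (psnd z))"]
      assms(2) unfolding decidable_def by (simp add: comp)
  then have P: "decidable (\<lambda>z. P (pfst z) (pfst (psnd z)))" unfolding decidable_def .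
  have "computable (\<lambda>x. rec_nat 0 (\<lambda>y v. if P x y then Suc 0 else v) (n x))"
    by (rule computable_rec_nat) (intro comp P assms(1))+
  then show ?thesis unfolding decidable_def rec .
qed

lemma decidable_ball [comp]:
  assumes "computable n" "decidable (\<lambda>z. P (pfst z) (psnd z))"
  shows "decidable (\<lambda>x. \<forall>y<n x. P x y)"
proof -
  have "decidable (\<lambda>x. \<not> (\<exists>y<n x. \<not> P x y))"
    by (rule decidable_not, rule decidable_bex, rule assms(1), rule decidable_not, rule assms(2))
  then show ?thesis by simp
qed

text \<open>One recursion computes remainder and quotient together: each round flips the remainder
  and raises the quotient when the remainder was 1. The initial value 0 codes the pair
  \<open>(0, 0)\<close>.\<close>

lemma computable_parity_half:
  "decidable odd \<and> computable (\<lambda>x. x div 2)"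
proof -
  define F where "F = rec_nat 0 (\<lambda>k v. if pfst v = 0 then pr 1 (psnd v) else pr 0 (Suc (psnd v)))"
  have F: "F n = pr (of_bool (odd n)) (n div 2)" for n
    
  proof (induction n)
    case 0
    then show ?case by (simp add: F_def prod_encode_def)
  next
    case (Suc n)
    then show ?case
      by (simp only: F_def nat.rec(2) pfst_pr psnd_pr) (simp add: odd_Suc_div_two even_Suc_div_two)
  qed
  have "computable F" unfolding F_def by (intro comp)
  then have "computable (\<lambda>x. pfst (F x))" "computable (\<lambda>x. psnd (F x))" by (intro comp; simp)+
  then show ?thesis unfolding F decidable_def by simp
qed

lemma decidable_odd [comp]: "computable f \<Longrightarrow> decidable (\<lambda>x. odd (f x))"
  using computable_compose[of "\<lambda>x. of_bool (odd x)" f] computable_parity_half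
  unfolding decidable_def by simp

lemma decidable_even [comp]: "computable f \<Longrightarrow> decidable (\<lambda>x. even (f x))"
  using decidable_not[OF decidable_odd] by simp

lemma computable_half [comp]: "computable f \<Longrightarrow> computable (\<lambda>x. f x div 2)"
  using computable_compose[of "\<lambda>x. x div 2" f] computable_parity_half by blast

lemma computable_div2_pow [comp]:
  "computable f \<Longrightarrow> computable g \<Longrightarrow> computable (\<lambda>x. f x div 2 ^ g x)"
proof -
  have "rec_nat m (\<lambda>k v. v div 2) n = m div 2 ^ n" for m n :: nat
    by (induction n) (auto simp: div_mult2_eq[symmetric] mult.commute)
  then show "computable f \<Longrightarrow> computable g \<Longrightarrow> ?thesis"
    using computable_rec_nat[of f g "\<lambda>_ _ v. v div 2"] by (simp add: comp)
qed

text \<open>Every number is read as an endless right-nested list, so no length is stored and access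
  is total. By \<open>ex_cnth\<close> any finite initial part can be prescribed.\<close>

definition cnth :: "nat \<Rightarrow> nat \<Rightarrow> nat" where
  "cnth w i = pfst ((psnd ^^ i) w)"

lemma computable_cnth [comp]:
  "computable f \<Longrightarrow> computable g \<Longrightarrow> computable (\<lambda>x. cnth (f x) (g x))"
proof -
  have "pfst (rec_nat w (\<lambda>k v. psnd v) n) = cnth w n" for w n
  proof -
    have "rec_nat w (\<lambda>k v. psnd v) n = (psnd ^^ n) w" by (induction n) simp_all
    then show ?thesis by (simp add: cnth_def)
  qed
  then show "computable f \<Longrightarrow> computable g \<Longrightarrow> ?thesis"
    using computable_pfst[OF computable_rec_nat[of f g "\<lambda>_ _ v. psnd v"]] by (simp add: comp)
qed

lemma ex_cnth: "\<exists>w. \<forall>i<n. cnth w i = g i"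
proof (induction n arbitrary: g)
  case (Suc n)
  obtain w where w: "\<forall>i<n. cnth w i = g (Suc i)" using Suc[of "\<lambda>i. g (Suc i)"] by auto
  have "cnth (pr (g 0) w) i = g i" if "i < Suc n" for i
    using that w by (cases i) (auto simp: cnth_def funpow_Suc_right simp del: funpow.simps(2))
  then show ?case by blast
qed simp

section \<open>A universal machine\<close>

text \<open>
  Machine states are \<open>st c v K\<close>: with \<open>c = Suc e\<close> the program with code \<open>e\<close> is about to be run on
  \<open>v\<close>, with \<open>c = 0\<close> the value \<open>v\<close> is returned to the stack \<open>K\<close> of pending frames. Frames
  of tag 0 and 1 wait for the two components of a \<open>Pair\<close>, those of tag 2 for the inner program of a
  \<open>Comp\<close>, of tag 3 for the previous value in a \<open>Prec\<close> and of tag 4 for one test of a \<open>Mu\<close>.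
\<close>

definition st :: "nat \<Rightarrow> nat \<Rightarrow> nat \<Rightarrow> nat" where
  "st c v K = pr c (pr v K)"

text \<open>The successor keeps 0 free for the empty stack.\<close>

definition push :: "nat \<Rightarrow> nat \<Rightarrow> nat \<Rightarrow> nat \<Rightarrow> nat" where
  "push t a b K = Suc (pr (pr t (pr a b)) K)"

text \<open>The payload \<open>(a, b)\<close> is, by tag: for 0 the second program and its input;
  for 1 the first value, in \<open>a\<close>; for 2 the outer program, in \<open>a\<close>; for 3
  the step program and the pair of parameter and counter; for 4 the tested program and the pair of
  input and candidate.\<close>

definition resume :: "nat \<Rightarrow> nat \<Rightarrow> nat \<Rightarrow> nat \<Rightarrow> nat \<Rightarrow> nat" where
  "resume t a b v K =
     (if t = 0 then st (Suc a) b (push 1 v 0 K)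
      else if t = 1 then st 0 (pr a v) K
      else if t = 2 then st (Suc a) v K
      else if t = 3 then st (Suc a) (pr (pfst b) (pr (psnd b) v)) K
      else if v = 0 then st 0 (psnd b) K
      else st (Suc a) (pr (pfst b) (Suc (psnd b))) (push 4 a (pr (pfst b) (Suc (psnd b))) K))"

text \<open>For codes from 4 on, the parities of \<open>e\<close> and \<open>e div 2\<close> reveal
  \<open>e mod 4\<close>, hence the constructor, and two halvings recover its argument; both
  operations are already known to be computable. A \<open>Prec\<close> with positive counter calls
  its own code with the counter lowered.\<close>

definition start :: "nat \<Rightarrow> nat \<Rightarrow> nat \<Rightarrow> nat" where
  "start e v K =
     (if e = 0 then st 0 0 K
      else if e = 1 then st 0 (Suc v) K
      else if e = 2 then st 0 (pfst v) K
      else if e = 3 then st 0 (psnd v) K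
      else
        (let m = (e - 4) div 2 div 2; p = pfst m; q = psnd m in
         if even e \<and> even (e div 2) then st (Suc p) v (push 0 q v K)
         else if even (e div 2) then st (Suc q) v (push 2 p 0 K)
         else if even e then
           (if psnd v = 0 then st (Suc p) (pfst v) K
            else st (Suc e) (pr (pfst v) (psnd v - 1)) (push 3 q (pr (pfst v) (psnd v - 1)) K))
         else st (Suc m) (pr v 0) (push 4 m (pr v 0) K)))"

definition step :: "nat \<Rightarrow> nat" where
  "step s =
     (let c = pfst s; v = pfst (psnd s); K = psnd (psnd s) in
      if c = 0 then
        (if K = 0 then s
         else resume (pfst (pfst (K - 1))) (pfst (psnd (pfst (K - 1)))) (psnd (psnd (pfst (K - 1))))
                v (psnd (K - 1)))
      else start (c - 1) v K)"

lemma step_halted [simp]: "step (st 0 v 0) = st 0 v 0"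
  by (simp add: step_def st_def)

lemma step_resume [simp]: "step (st 0 v (push t a b K)) = resume t a b v K"
  by (simp add: step_def st_def push_def)

lemma step_start [simp]: "step (st (Suc e) v K) = start e v K"
  by (simp add: step_def st_def)

lemma start_simps [simp]:
  "start 0 v K = st 0 0 K"
  "start (Suc 0) v K = st 0 (Suc v) K"
  "start 2 v K = st 0 (pfst v) K"
  "start 3 v K = st 0 (psnd v) K"
  "start (4 * pr p q + 4) v K = st (Suc p) v (push 0 q v K)"
  "start (4 * pr p q + 5) v K = st (Suc q) v (push 2 p 0 K)"
  "start (4 * pr p q + 6) v K =
     (if psnd v = 0 then st (Suc p) (pfst v) K
      else st (Suc (4 * pr p q + 6)) (pr (pfst v) (psnd v - 1)) (push 3 q (pr (pfst v) (psnd v - 1)) K))"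
  "start (4 * m + 7) v K = st (Suc m) (pr v 0) (push 4 m (pr v 0) K)"
proof -
  show "start (4 * pr p q + 4) v K = st (Suc p) v (push 0 q v K)"
  proof -
    have "(4 * pr p q + 4 - 4) div 2 div 2 = pr p q" "even (4 * pr p q + 4)" "even ((4 * pr p q + 4) div 2)"
      by presburger+
    then show ?thesis by (simp add: start_def Let_def)
  qed
  show "start (4 * pr p q + 5) v K = st (Suc q) v (push 2 p 0 K)"
  proof -
    have "(4 * pr p q + 5 - 4) div 2 div 2 = pr p q" "odd (4 * pr p q + 5)" "even ((4 * pr p q + 5) div 2)"
      by presburger+
    then show ?thesis by (simp add: start_def Let_def)
  qed
  show "start (4 * pr p q + 6) v K =
     (if psnd v = 0 then st (Suc p) (pfst v) K
      else st (Suc (4 * pr p q + 6)) (pr (pfst v) (psnd v - 1)) (push 3 q (pr (pfst v) (psnd v - 1)) K))"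
  proof -
    have "(4 * pr p q + 6 - 4) div 2 div 2 = pr p q" "even (4 * pr p q + 6)" "odd ((4 * pr p q + 6) div 2)"
      by presburger+
    then show ?thesis by (simp add: start_def Let_def)
  qed
  show "start (4 * m + 7) v K = st (Suc m) (pr v 0) (push 4 m (pr v 0) K)"
  proof -
    have "(4 * m + 7 - 4) div 2 div 2 = m" "odd (4 * m + 7)" "odd ((4 * m + 7) div 2)"
      by presburger+
    then show ?thesis by (simp add: start_def Let_def)
  qed
qed (simp_all add: start_def)

text \<open>Keeps the code of \<open>Prec p q\<close> folded, as the machine calls this very code
  again.\<close>

lemma start_Prec:
  "start (prog_encode (Prec p q)) v K =
     (if psnd v = 0 then st (Suc (prog_encode p)) (pfst v) K
      else st (Suc (prog_encode (Prec p q))) (pr (pfst v) (psnd v - 1))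
             (push 3 (prog_encode q) (pr (pfst v) (psnd v - 1)) K))"
  unfolding prog_encode.simps by (rule start_simps)

lemma computable_step [comp]: 
  assumes "computable f" shows "computable (\<lambda>x. step (f x))"
proof -
  have "computable step"
    unfolding step_def start_def resume_def st_def push_def Let_def by (intro comp)
  then show ?thesis using assms by (rule computable_compose)
qed

section \<open>Soundness of the machine\<close>

text \<open>The search of \<open>Mu\<close> begun at \<open>n\<close>: a frame of tag 4 resumes a
  search that is under way, so its denotation needs a variable starting point.\<close>

definition mu_from :: "prog \<Rightarrow> nat \<Rightarrow> nat \<Rightarrow> nat option" where
  "mu_from p x n =
     (if \<exists>k\<ge>n. eval p (pr x k) = Some 0 \<and> (\<forall>m. n \<le> m \<and> m < k \<longrightarrow> (\<exists>v. eval p (pr x m) = Some (Suc v)))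
      then Some (LEAST k. n \<le> k \<and> eval p (pr x k) = Some 0) else None)"

lemma mu_from_0: "mu_from p x 0 = eval (Mu p) x"
  by (simp add: mu_from_def)

lemma mu_from_None: "eval p (pr x n) = None \<Longrightarrow> mu_from p x n = None"
  unfolding mu_from_def by (auto simp: le_less)

lemma mu_from_hit: "eval p (pr x n) = Some 0 \<Longrightarrow> mu_from p x n = Some n"
  unfolding mu_from_def by (auto intro!: Least_equality exI[of _ n])

lemma mu_from_miss:
  assumes "eval p (pr x n) = Some (Suc v)" shows "mu_from p x n = mu_from p x (Suc n)"
proof -
  have ge: "n \<le> k \<and> eval p (pr x k) = Some 0 \<longleftrightarrow> Suc n \<le> k \<and> eval p (pr x k) = Some 0" for k
    using assms by (cases "k = n") auto
  have lt: "(\<forall>m. n \<le> m \<and> m < k \<longrightarrow> (\<exists>v. eval p (pr x m) = Some (Suc v))) \<longleftrightarrow>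
            (\<forall>m. Suc n \<le> m \<and> m < k \<longrightarrow> (\<exists>v. eval p (pr x m) = Some (Suc v)))" for k
    using assms by (metis Suc_leD not_less_eq_eq antisym_conv2 le_neq_implies_less not_less)
  show ?thesis unfolding mu_from_def ge[symmetric] using ge lt by (smt (verit) )
qed

text \<open>The denotation of a stack is the partial function that resumes its frames one after the other.
  It is preserved by every step of the machine, which therefore computes no wrong value.\<close>

definition frame_sem :: "nat \<Rightarrow> nat \<Rightarrow> nat \<Rightarrow> nat \<Rightarrow> nat option" where
  "frame_sem t a b v =
     (if t = 0 then map_option (\<lambda>u. pr v u) (phi a b)
      else if t = 1 then Some (pr a v)
      else if t = 2 then phi a v
      else if t = 3 then phi a (pr (pfst b) (pr (psnd b) v))
      else if v = 0 then Some (psnd b)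
      else mu_from (inv prog_encode a) (pfst b) (Suc (psnd b)))"

function stack_sem :: "nat \<Rightarrow> nat \<Rightarrow> nat option" where
  "stack_sem K v =
     (if K = 0 then Some v
      else Option.bind (frame_sem (pfst (pfst (K - 1))) (pfst (psnd (pfst (K - 1))))
             (psnd (psnd (pfst (K - 1)))) v) (stack_sem (psnd (K - 1))))"
  by auto
termination
proof (relation "measure fst")
  fix K x :: nat
  assume "K \<noteq> 0"
  have "psnd (K - 1) \<le> K - 1" by (metis le_prod_encode_2 pr_collapse)
  then show "((psnd (K - 1), x), K, y) \<in> measure fst" for y using \<open>K \<noteq> 0\<close> by simp
qed simp

declare stack_sem.simps [simp del]

lemma stack_sem_0 [simp]: "stack_sem 0 = Some"
  by (rule ext, subst stack_sem.simps) simp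

lemma stack_sem_push [simp]:
  "stack_sem (push t a b K) = (\<lambda>v. Option.bind (frame_sem t a b v) (stack_sem K))"
  by (rule ext, subst stack_sem.simps) (simp add: push_def)

definition state_sem :: "nat \<Rightarrow> nat option" where
  "state_sem s =
     (if pfst s = 0 then stack_sem (psnd (psnd s)) (pfst (psnd s))
      else Option.bind (phi (pfst s - 1) (pfst (psnd s))) (stack_sem (psnd (psnd s))))"

lemma state_sem_return [simp]: "state_sem (st 0 v K) = stack_sem K v"
  by (simp add: state_sem_def st_def)

lemma state_sem_start [simp]: "state_sem (st (Suc e) v K) = Option.bind (phi e v) (stack_sem K)"
  by (simp add: state_sem_def st_def)

lemma st_cases: obtains c v K where "s = st c v K"
  unfolding st_def by (metis pr_collapse)

lemma stack_cases: obtains "K = 0" | t a b K' where "K = push t a b K'"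
proof (cases K)
  case (Suc k)
  then have "K = push (pfst (pfst k)) (pfst (psnd (pfst k))) (psnd (psnd (pfst k))) (psnd k)"
    by (simp add: push_def)
  then show ?thesis using that by blast
qed (use that in blast)

lemma eval_Prec_0: "psnd x = 0 \<Longrightarrow> eval (Prec p q) x = eval p (pfst x)"
  by (simp add: pfst_def psnd_def)

lemma eval_Prec_Suc:
  "psnd x = Suc k \<Longrightarrow> eval (Prec p q) x =
     Option.bind (eval (Prec p q) (pr (pfst x) k)) (\<lambda>v. eval q (pr (pfst x) (pr k v)))"
  by (simp add: pfst_def psnd_def)

lemma inv_prog_encode [simp]: "inv prog_encode (prog_encode p) = p"
  by (simp add: bij_prog_encode bij_is_inj)

lemma state_sem_resume: "state_sem (resume t a b v K) = Option.bind (frame_sem t a b v) (stack_sem K)"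
proof -
  obtain p where [simp]: "a = prog_encode p" using prog_encode_surj by metis
  have "mu_from p y n = (case eval p (pr y n) of None \<Rightarrow> None | Some 0 \<Rightarrow> Some n
      | Some (Suc u) \<Rightarrow> mu_from p y (Suc n))" for y n
    by (auto simp: mu_from_None mu_from_hit mu_from_miss split: option.split nat.split)
  from this[of "pfst b" "Suc (psnd b)"] show ?thesis
    by (auto simp: resume_def frame_sem_def map_conv_bind_option split: option.split nat.split)
qed

text \<open>A case distinction suffices: the components that the machine calls are denoted by
  \<open>phi\<close> already, so each case unfolds one layer of \<open>eval\<close>.\<close>

lemma state_sem_start_prog:
  "state_sem (start (prog_encode p) v K) = Option.bind (eval p v) (stack_sem K)"
proof (cases p)
  case (Pair p q)
  have "Option.bind (eval p v) (\<lambda>a. Option.bind (map_option (pr a) (eval q v)) (stack_sem K)) =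
        Option.bind (eval (Pair p q) v) (stack_sem K)"
    by (cases "eval p v"; cases "eval q v") simp_all
  then show ?thesis unfolding Pair by (simp add: frame_sem_def)
next
  case (Comp p q)
  then show ?thesis by (simp add: frame_sem_def)
next
  case (Prec p q)
  show ?thesis
  proof (cases "psnd v")
    case 0
    then show ?thesis unfolding Prec by (simp add: eval_Prec_0 del: eval.simps)
  next
    case (Suc k)
    then show ?thesis unfolding Prec
      by (simp add: start_Prec eval_Prec_Suc frame_sem_def del: eval.simps prog_encode.simps)
  qed
next
  case (Mu p)
  have "mu_from p v 0 = (case eval p (pr v 0) of None \<Rightarrow> None | Some 0 \<Rightarrow> Some 0
      | Some (Suc u) \<Rightarrow> mu_from p v (Suc 0))"
    by (auto simp: mu_from_None mu_from_hit mu_from_miss split: option.split nat.split)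
  then show ?thesis unfolding Mu
    by (auto simp: mu_from_0 frame_sem_def simp del: eval.simps(8) split: option.splits nat.splits)
qed (simp_all add: pfst_def psnd_def)

lemma state_sem_step: "state_sem (step s) = state_sem s"
proof -
  obtain c v K where s: "s = st c v K" by (rule st_cases)
  show ?thesis
  proof (cases c)
    case 0
    then show ?thesis unfolding s
      by (cases K rule: stack_cases) (simp_all add: state_sem_resume)
  next
    case (Suc e)
    obtain p where "e = prog_encode p" using prog_encode_surj by metis
    then show ?thesis unfolding s Suc by (simp add: state_sem_start_prog)
  qed
qed

lemma state_sem_funpow: "state_sem ((step ^^ t) s) = state_sem s"
  by (induction t) (simp_all add: state_sem_step)

section \<open>Completeness of the machine\<close>

definition reaches :: "nat \<Rightarrow> nat \<Rightarrow> bool" where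
  "reaches s s' \<longleftrightarrow> (\<exists>t. (step ^^ t) s = s')"

lemma reaches_refl [simp]: "reaches s s"
  unfolding reaches_def by (rule exI[of _ 0]) simp

lemma reaches_trans [trans]: "reaches s s' \<Longrightarrow> reaches s' s'' \<Longrightarrow> reaches s s''"
  unfolding reaches_def by (metis comp_apply funpow_add)

lemma reaches_step: "reaches (step s) s' \<Longrightarrow> reaches s s'"
  unfolding reaches_def by (metis comp_apply funpow_Suc_right)

lemma reaches_start: "reaches (start e v K) s \<Longrightarrow> reaches (st (Suc e) v K) s"
  by (rule reaches_step) simp

text \<open>Invariance of the denotation says nothing about termination, which is obtained here by
  induction on programs. The stack \<open>K\<close> is arbitrary because subprograms run above
  pushed frames.\<close>

lemma eval_reaches: "eval p x = Some v \<Longrightarrow> reaches (st (Suc (prog_encode p)) x K) (st 0 v K)"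
proof (induction p arbitrary: x v K)
  case (Pair p q)
  then obtain a b where a: "eval p x = Some a" and b: "eval q x = Some b" and v: "v = pr a b"
    by (auto simp: bind_eq_Some_conv)
  have "reaches (st (Suc (prog_encode p)) x (push 0 (prog_encode q) x K))
      (st 0 a (push 0 (prog_encode q) x K))"
    by (rule Pair.IH(1)[OF a])
  also have "reaches \<dots> (st (Suc (prog_encode q)) x (push 1 a 0 K))"
    by (rule reaches_step) (simp add: resume_def)
  also have "reaches \<dots> (st 0 b (push 1 a 0 K))" by (rule Pair.IH(2)[OF b])
  also have "reaches \<dots> (st 0 v K)" by (rule reaches_step) (simp add: resume_def v)
  finally show ?case by - (rule reaches_start, simp)
next
  case (Comp p q)
  then obtain a where a: "eval q x = Some a" and v: "eval p a = Some v"
    by (auto simp: bind_eq_Some_conv)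
  have "reaches (st (Suc (prog_encode q)) x (push 2 (prog_encode p) 0 K))
      (st 0 a (push 2 (prog_encode p) 0 K))"
    by (rule Comp.IH(2)[OF a])
  also have "reaches \<dots> (st (Suc (prog_encode p)) a K)"
    by (rule reaches_step) (simp add: resume_def)
  also have "reaches \<dots> (st 0 v K)" by (rule Comp.IH(1)[OF v])
  finally show ?case by - (rule reaches_start, simp)
next
  case (Prec p q)
  \<comment> \<open>The machine calls \<open>Prec p q\<close> itself with a smaller counter, hence
    an inner induction on the counter.\<close>
  have "eval (Prec p q) (pr a k) = Some v \<Longrightarrow>
      reaches (st (Suc (prog_encode (Prec p q))) (pr a k) K) (st 0 v K)" for a k v K
  proof (induction k arbitrary: v K)
    case 0
    then have "eval p a = Some v" by simp
    from Prec.IH(1)[OF this, of K] show ?case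
      by - (rule reaches_start, simp add: start_Prec del: prog_encode.simps)
  next
    case (Suc k)
    then obtain u where u: "eval (Prec p q) (pr a k) = Some u"
      and v: "eval q (pr a (pr k u)) = Some v"
      by (auto simp: bind_eq_Some_conv)
    let ?K = "push 3 (prog_encode q) (pr a k) K"
    have "reaches (st (Suc (prog_encode (Prec p q))) (pr a k) ?K) (st 0 u ?K)"
      by (rule Suc.IH[OF u])
    also have "reaches \<dots> (st (Suc (prog_encode q)) (pr a (pr k u)) K)"
      by (rule reaches_step) (simp add: resume_def)
    also have "reaches \<dots> (st 0 v K)" by (rule Prec.IH(2)[OF v])
    finally show ?case by - (rule reaches_start, simp add: start_Prec del: prog_encode.simps)
  qed
  from this[of "pfst x" "psnd x"] Prec.prems show ?case by (simp del: eval.simps prog_encode.simps)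
next
  case (Mu p)
  let ?hit = "\<lambda>n. eval p (pr x n) = Some 0"
  from Mu.prems obtain n where n: "?hit n" "\<forall>m<n. \<exists>u. eval p (pr x m) = Some (Suc u)"
    and v: "v = (LEAST n. ?hit n)"
    by (auto split: if_splits)
  have "v = n" unfolding v
  proof (rule Least_equality)
    show "n \<le> m" if "?hit m" for m
      using that n(2) by (cases "m < n") auto
  qed (rule n(1))
  let ?K = "\<lambda>j. push 4 (prog_encode p) (pr x j) K"
  \<comment> \<open>Downward induction from the hit \<open>n\<close>, where the search stops: the
    failed test at \<open>j\<close> leads to the test at \<open>Suc j\<close>.\<close>
  have "reaches (st (Suc (prog_encode p)) (pr x j) (?K j)) (st 0 n K)" if "j \<le> n" for j
    using that
  proof (induction j rule: inc_induct)
    case base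
    have "reaches (st (Suc (prog_encode p)) (pr x n) (?K n)) (st 0 0 (?K n))"
      by (rule Mu.IH[OF n(1)])
    also have "reaches \<dots> (st 0 n K)" by (rule reaches_step) (simp add: resume_def)
    finally show ?case .
  next
    case (step j)
    obtain u where u: "eval p (pr x j) = Some (Suc u)" using n(2) step.hyps by blast
    have "reaches (st (Suc (prog_encode p)) (pr x j) (?K j)) (st 0 (Suc u) (?K j))"
      by (rule Mu.IH[OF u])
    also have "reaches \<dots> (st (Suc (prog_encode p)) (pr x (Suc j)) (?K (Suc j)))"
      by (rule reaches_step) (simp add: resume_def)
    also note step.IH
    finally show ?case .
  qed
  from this[of 0] show ?case unfolding \<open>v = n\<close> by - (rule reaches_start, simp)
qed (rule reaches_start; simp add: pfst_def psnd_def)+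

theorem phi_eq_Some_iff:
  "phi e x = Some v \<longleftrightarrow> (\<exists>t. (step ^^ t) (st (Suc e) x 0) = st 0 v 0)"
proof
  obtain p where [simp]: "e = prog_encode p" using prog_encode_surj by metis
  assume "phi e x = Some v"
  then show "\<exists>t. (step ^^ t) (st (Suc e) x 0) = st 0 v 0"
    using eval_reaches[of p x v 0] by (simp add: reaches_def)
next
  assume "\<exists>t. (step ^^ t) (st (Suc e) x 0) = st 0 v 0"
  then have "state_sem (st (Suc e) x 0) = state_sem (st 0 v 0)" using state_sem_funpow by metis
  then show "phi e x = Some v" by (cases "phi e x") simp_all
qed

section \<open>Step-bounded evaluation and enumeration by stages\<close>

text \<open>A total function: 0 stands for a run not yet halted, so values are shifted by
  one.\<close>

definition res :: "nat \<Rightarrow> nat \<Rightarrow> nat \<Rightarrow> nat" where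
  "res e x t =
     (let s = (step ^^ t) (st (Suc e) x 0)
      in if pfst s = 0 \<and> psnd (psnd s) = 0 then Suc (pfst (psnd s)) else 0)"

lemma res_eq_Suc_iff: "res e x t = Suc v \<longleftrightarrow> (step ^^ t) (st (Suc e) x 0) = st 0 v 0"
proof -
  obtain c u K where "(step ^^ t) (st (Suc e) x 0) = st c u K" by (rule st_cases)
  then show ?thesis by (auto simp: res_def st_def)
qed

lemma phi_eq_Some_iff_res: "phi e x = Some v \<longleftrightarrow> (\<exists>t. res e x t = Suc v)"
  by (simp add: phi_eq_Some_iff res_eq_Suc_iff)

lemma res_mono:
  assumes "res e x t = Suc v" "t \<le> t'" shows "res e x t' = Suc v"
proof -
  have "(step ^^ n) (st 0 v 0) = st 0 v 0" for n by (induction n) simp_all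
  moreover have "t' = (t' - t) + t" using assms(2) by simp
  ultimately show ?thesis using assms(1) unfolding res_eq_Suc_iff by (metis comp_apply funpow_add)
qed

lemma computable_res [comp]:
  assumes "computable f" "computable g" "computable h"
  shows "computable (\<lambda>x. res (f x) (g x) (h x))"
proof -
  have "(step ^^ t) s = rec_nat s (\<lambda>k v. step v) t" for t s by (induction t) simp_all
  then show ?thesis unfolding res_def Let_def st_def by (simp only:) (intro comp assms)
qed

text \<open>The stage \<open>t\<close> bounds both running times and the inputs \<open>y\<close> of
  the enumerating machine. The bound on \<open>i\<close> only serves to make its quantifier bounded,
  hence decidable.\<close>

definition enumd :: "nat \<Rightarrow> nat \<Rightarrow> nat \<Rightarrow> nat \<Rightarrow> bool" where
  "enumd e n c t \<longleftrightarrow> (\<exists>y<t. \<exists>i<Suc (res e n t). res e n t = Suc i \<and> res i y t = Suc c)"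

lemma enumd_mono: "enumd e n c t \<Longrightarrow> t \<le> t' \<Longrightarrow> enumd e n c t'"
  unfolding enumd_def by (metis lessI less_SucI order_less_le_trans res_mono)

lemma decidable_enumd [comp]:
  assumes "computable f" "computable g" "computable h" "computable k"
  shows "decidable (\<lambda>x. enumd (f x) (g x) (h x) (k x))"
proof -
  have "decidable (\<lambda>z. enumd (pfst z) (pfst (psnd z)) (pfst (psnd (psnd z))) (psnd (psnd (psnd z))))"
    unfolding enumd_def by (intro comp)
  from computable_compose[OF this[unfolded decidable_def], of "\<lambda>x. pr (f x) (pr (g x) (pr (h x) (k x)))"]
  show ?thesis unfolding decidable_def by (simp add: comp assms)
qed

lemma ex_enumd_iff:
  assumes "phi e n = Some i" shows "(\<exists>t. enumd e n c t) \<longleftrightarrow> c \<in> ran (phi i)"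
proof
  assume "\<exists>t. enumd e n c t"
  then obtain t y j where "res e n t = Suc j" "res j y t = Suc c" unfolding enumd_def by blast
  then have "phi e n = Some j" "phi j y = Some c" unfolding phi_eq_Some_iff_res by blast+
  then show "c \<in> ran (phi i)" using assms by (auto simp: ran_def)
next
  assume "c \<in> ran (phi i)"
  then obtain y where "phi i y = Some c" by (auto simp: ran_def)
  with assms obtain t t' where t: "res e n t = Suc i" "res i y t' = Suc c"
    unfolding phi_eq_Some_iff_res by blast
  define u where "u = Suc (t + t' + y)"
  have "res e n u = Suc i" "res i y u = Suc c" using t by (auto intro: res_mono simp: u_def)
  moreover have "y < u" by (simp add: u_def)
  ultimately show "\<exists>t. enumd e n c t" unfolding enumd_def by (intro exI[of _ u] exI[of _ y] exI[of _ i]) simp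
qed

lemma tree_at_eq:
  assumes "phi e n = Some i" "pi01_index i T" shows "tree_at e n = T"
  unfolding tree_at_def using assms pi01_index_unique by (intro the_equality) auto

text \<open>The interface to the machine for the upper bound: each complement is the increasing
  union of decidable stages.\<close>

lemma weakly_effective_tree:
  assumes "weakly_effective_class e"
  shows "is_tree (tree_at e n)"
    and "(\<exists>t. enumd e n (string_encode \<sigma>) t) \<longleftrightarrow> \<sigma> \<notin> tree_at e n"
proof -
  obtain i T where i: "phi e n = Some i" "pi01_index i T"
    using assms unfolding weakly_effective_class_def by blast
  have T: "tree_at e n = T" by (rule tree_at_eq[OF i])
  show "is_tree (tree_at e n)" using i(2) unfolding T pi01_index_def by blast
  have "string_encode ` (- T) = ran (phi i)" using i(2) unfolding pi01_index_def by blast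
  then have "string_encode \<sigma> \<in> ran (phi i) \<longleftrightarrow> \<sigma> \<notin> T"
    using bij_is_inj[OF bij_string_encode] by (metis ComplD ComplI inj_image_mem_iff)
  then show "(\<exists>t. enumd e n (string_encode \<sigma>) t) \<longleftrightarrow> \<sigma> \<notin> tree_at e n"
    unfolding T ex_enumd_iff[OF i(1)] .
qed

section \<open>The upper bound\<close>

text \<open>The first bit is the least significant digit, so an appended string fills the higher
  digits. This makes extension of strings an arithmetical operation in
  \<open>matrix\<close>.\<close>

lemma string_encode_append:
  "string_encode (\<sigma> @ \<tau>) = string_encode \<sigma> + 2 ^ length \<sigma> * string_encode \<tau>"
  by (induction \<sigma>) (auto simp: algebra_simps)

text \<open>The strings of length \<open>k\<close> occupy exactly the codes from
  \<open>2 ^ k - 1\<close> to \<open>2 ^ (k + 1) - 2\<close>, so length can be tested on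
  codes.\<close>

lemma string_encode_bounds:
  "2 ^ length \<sigma> \<le> Suc (string_encode \<sigma>)" "Suc (string_encode \<sigma>) < 2 * 2 ^ length \<sigma>"
  by (induction \<sigma>) auto

lemma length_eq_if_string_encode_bounds:
  assumes "2 ^ k \<le> Suc (string_encode \<sigma>)" "Suc (string_encode \<sigma>) < 2 * 2 ^ k"
  shows "length \<sigma> = k"
proof -
  have "(2::nat) ^ k < 2 ^ Suc (length \<sigma>)" "(2::nat) ^ length \<sigma> < 2 ^ Suc k"
    using assms string_encode_bounds[of \<sigma>] by auto
  then show ?thesis by (simp add: power_strict_increasing_iff del: power_Suc)
qed

text \<open>Koenig's lemma: a string with infinitely many extensions in \<open>T\<close> has a child
  with infinitely many, and following such children gives the path.\<close>

lemma infinite_tree_has_path: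
  assumes T: "is_tree T" and inf: "infinite T" shows "\<exists>x. x \<in> paths T"
proof -
  define E where "E \<tau> = {\<rho>. \<tau> @ \<rho> \<in> T}" for \<tau>
  have step: "\<exists>b. infinite (E (\<tau> @ [b]))" if "infinite (E \<tau>)" for \<tau>
  proof (rule ccontr)
    assume "\<not> ?thesis"
    then have "finite (insert [] ((#) True ` E (\<tau> @ [True]) \<union> (#) False ` E (\<tau> @ [False])))"
      by simp
    moreover have "E \<tau> \<subseteq> insert [] ((#) True ` E (\<tau> @ [True]) \<union> (#) False ` E (\<tau> @ [False]))"
    proof
      fix \<rho> assume "\<rho> \<in> E \<tau>"
      then show "\<rho> \<in> insert [] ((#) True ` E (\<tau> @ [True]) \<union> (#) False ` E (\<tau> @ [False]))"
        by (cases \<rho>; cases "hd \<rho>") (auto simp: E_def)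
    qed
    ultimately show False using that finite_subset by blast
  qed
  then obtain b where b: "\<And>\<tau>. infinite (E \<tau>) \<Longrightarrow> infinite (E (\<tau> @ [b \<tau>]))" by metis
  define f where "f = rec_nat [] (\<lambda>_ \<tau>. \<tau> @ [b \<tau>])"
  define x where "x n = b (f n)" for n
  have f: "map x [0..<n] = f n" for n by (induction n) (simp_all add: f_def x_def)
  have "infinite (E (f n))" for n
    by (induction n) (use inf b in \<open>simp_all add: f_def E_def\<close>)
  then have "\<exists>\<rho>. f n @ \<rho> \<in> T" for n unfolding E_def by (metis Collect_empty_eq finite.emptyI)
  then have "f n \<in> T" for n using T unfolding is_tree_def by blast
  then have "x \<in> paths T" by (simp add: paths_def f)
  then show ?thesis by blast
qed

lemma map_upt_split: "m \<le> n \<Longrightarrow> map x [0..<n] = map x [0..<m] @ map x [m..<n]"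
  by (metis le_add_diff_inverse map_append upt_add_eq_append zero_le)

text \<open>Koenig's lemma is applied to the tree of common extensions of \<open>\<sigma>\<close>,
  and \<open>\<sigma>\<close> is put in front of the path found there.\<close>

lemma infinite_tree_has_path_through:
  assumes T: "\<And>A. A \<in> F \<Longrightarrow> is_tree (T A)"
    and inf: "infinite {\<rho>. \<forall>A\<in>F. \<sigma> @ \<rho> \<in> T A}"
  shows "\<exists>x. map x [0..<length \<sigma>] = \<sigma> \<and> (\<forall>A\<in>F. x \<in> paths (T A))"
proof -
  have "is_tree {\<rho>. \<forall>A\<in>F. \<sigma> @ \<rho> \<in> T A}"
    unfolding is_tree_def
  proof (intro allI impI)
    fix \<rho> \<tau> assume "\<rho> @ \<tau> \<in> {\<rho>. \<forall>A\<in>F. \<sigma> @ \<rho> \<in> T A}"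
    then have "(\<sigma> @ \<rho>) @ \<tau> \<in> T A" if "A \<in> F" for A using that by simp
    then show "\<rho> \<in> {\<rho>. \<forall>A\<in>F. \<sigma> @ \<rho> \<in> T A}" using T unfolding is_tree_def by blast
  qed
  then obtain y where y: "y \<in> paths {\<rho>. \<forall>A\<in>F. \<sigma> @ \<rho> \<in> T A}"
    using infinite_tree_has_path inf by blast
  define x where "x i = (if i < length \<sigma> then \<sigma> ! i else y (i - length \<sigma>))" for i
  have \<sigma>: "map x [0..<length \<sigma>] = \<sigma>" by (rule nth_equalityI) (simp_all add: x_def)
  have pre: "map x [0..<length \<sigma> + n] = \<sigma> @ map y [0..<n]" for n
  proof -
    have "map x [length \<sigma>..<length \<sigma> + n] = map y [0..<n]"
      by (rule nth_equalityI) (simp_all add: x_def)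
    then show ?thesis
      using \<sigma> map_upt_split[of "length \<sigma>" "length \<sigma> + n" x] by simp
  qed
  have "x \<in> paths (T A)" if "A \<in> F" for A
  proof -
    \<comment> \<open>Going up to length \<open>n + length \<sigma>\<close> and back by closure of
      \<open>T A\<close> also covers prefixes shorter than \<open>\<sigma>\<close>.\<close>
    have "map x [0..<n] \<in> T A" for n
    proof -
      have "map x [0..<n + length \<sigma>] = map x [0..<n] @ map x [n..<n + length \<sigma>]"
        by (rule map_upt_split) simp
      moreover have "map x [0..<n + length \<sigma>] \<in> T A"
        using pre[of n] y that by (simp add: paths_def add.commute)
      ultimately show ?thesis using T[OF that] unfolding is_tree_def by metis
    qed
    then show ?thesis by (simp add: paths_def)
  qed
  then show ?thesis using \<sigma> by blast
qed

lemma uniform_bound: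
  assumes "finite S" and "\<And>a. a \<in> S \<Longrightarrow> \<exists>n::nat. P a n"
    and mono: "\<And>a n n'. P a n \<Longrightarrow> n \<le> n' \<Longrightarrow> P a n'"
  shows "\<exists>n. \<forall>a\<in>S. P a n"
  using assms(1,2)
proof (induction S)
  case (insert a S)
  obtain n where "P a n" using insert.prems[of a] by blast
  moreover obtain n' where "\<forall>a\<in>S. P a n'" using insert.IH insert.prems by blast
  ultimately have "\<forall>a\<in>insert a S. P a (n + n')" using mono by (auto intro: le_add1 le_add2)
  then show ?case by blast
qed simp

section \<open>Finite patterns as a \<open>\<Sigma>\<^sub>2\<close> condition\<close>

text \<open>The single number \<open>m\<close> bounds both the points and the codes of the
  prescribed subsets. For one \<open>m\<close> this is weaker than shattering \<open>m\<close>
  points, but for all \<open>m\<close> together it expresses infinite VC dimension.\<close>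

definition pattern :: "(nat \<Rightarrow> 'a set) \<Rightarrow> nat \<Rightarrow> (nat \<Rightarrow> 'a) \<Rightarrow> (nat \<Rightarrow> nat) \<Rightarrow> bool" where
  "pattern c m x N \<longleftrightarrow> (\<forall>i<m. \<forall>A<m. x i \<in> c (N A) \<longleftrightarrow> i \<in> set_decode A)"

text \<open>
  In a witness \<open>w\<close> the strings with codes \<open>U i\<close> and length \<open>k\<close> are initial segments of the points,
  excluded by stage \<open>t\<close> from the concepts that must not contain them. By compactness the concepts that
  must contain a point have a common path through its initial segment iff they have common nodes
  above it of arbitrarily large code.
\<close>

definition matrix :: "nat \<Rightarrow> nat \<Rightarrow> nat \<Rightarrow> nat \<Rightarrow> bool" where
  "matrix e m w s \<longleftrightarrow>
     (let k = pfst w; U = cnth (pfst (psnd w)); N = cnth (pfst (psnd (psnd w))); t = psnd (psnd (psnd w));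
          l = pfst s; t' = psnd s in
      \<forall>i<m. 2 ^ k \<le> Suc (U i) \<and> Suc (U i) < 2 * 2 ^ k \<and>
        (\<forall>A<m. \<not> odd (A div 2 ^ i) \<longrightarrow> enumd e (N A) (U i) t) \<and>
        (\<exists>\<rho><2 * 2 ^ l. l \<le> \<rho> \<and>
           (\<forall>A<m. odd (A div 2 ^ i) \<longrightarrow> \<not> enumd e (N A) (U i + 2 ^ k * \<rho>) t')))"

lemma decidable_matrix:
  "decidable (\<lambda>z. matrix (pfst (pfst (pfst z))) (psnd (pfst (pfst z))) (psnd (pfst z)) (psnd z))"
  unfolding matrix_def Let_def by (intro comp)

text \<open>Only finitely many pairs \<open>(i, A)\<close> call for an exclusion, so one length
  \<open>k\<close> and then one stage \<open>t\<close> serve them all. The other clauses hold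
  because initial segments of \<open>x i\<close> are never enumerated where \<open>x i\<close>
  belongs to the concept.\<close>

lemma pattern_imp_matrix:
  assumes e: "weakly_effective_class e" and pat: "pattern (concept_at e) m x N"
  shows "\<exists>w. \<forall>s. matrix e m w s"
proof -
  let ?P = "\<lambda>(i, A) n. i \<notin> set_decode A \<longrightarrow> map (x i) [0..<n] \<notin> tree_at e (N A)"
  note tree = weakly_effective_tree(1)[OF e] and enumd = weakly_effective_tree(2)[OF e]
  have "\<exists>k. \<forall>a\<in>{..<m} \<times> {..<m}. ?P a k"
  proof (rule uniform_bound)
    show "\<exists>n. ?P a n" if "a \<in> {..<m} \<times> {..<m}" for a
      using pat that unfolding pattern_def concept_at_def paths_def by (cases a) auto
    show "?P a n'" if "?P a n" "n \<le> n'" for a n n'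
    proof -
      have "map (x i) [0..<n'] = map (x i) [0..<n] @ map (x i) [n..<n']" for i
        using that(2) by (rule map_upt_split)
      then show ?thesis using that(1) tree unfolding is_tree_def by (cases a) auto
    qed
  qed simp
  then obtain k where k: "\<And>i A. i < m \<Longrightarrow> A < m \<Longrightarrow> i \<notin> set_decode A \<Longrightarrow>
      map (x i) [0..<k] \<notin> tree_at e (N A)"
    by auto
  let ?Q = "\<lambda>(i, A) t. i \<notin> set_decode A \<longrightarrow> enumd e (N A) (string_encode (map (x i) [0..<k])) t"
  have "\<exists>t. \<forall>a\<in>{..<m} \<times> {..<m}. ?Q a t"
  proof (rule uniform_bound)
    show "\<exists>t. ?Q a t" if "a \<in> {..<m} \<times> {..<m}" for a
      using k enumd that by (cases a) auto
    show "?Q a n'" if "?Q a n" "n \<le> n'" for a n n'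
      using that by (cases a) (auto intro: enumd_mono)
  qed simp
  then obtain t where t: "\<And>i A. i < m \<Longrightarrow> A < m \<Longrightarrow> i \<notin> set_decode A \<Longrightarrow>
      enumd e (N A) (string_encode (map (x i) [0..<k])) t"
    by auto
  obtain u where u: "\<forall>i<m. cnth u i = string_encode (map (x i) [0..<k])"
    using ex_cnth[of m "\<lambda>i. string_encode (map (x i) [0..<k])"] by blast
  obtain v where v: "\<forall>i<m. cnth v i = N i" using ex_cnth[of m N] by blast
  have "matrix e m (pr k (pr u (pr v t))) s" for s
  proof -
    have "\<exists>\<rho><2 * 2 ^ pfst s. pfst s \<le> \<rho> \<and>
           (\<forall>A<m. i \<in> set_decode A \<longrightarrow>
              \<not> enumd e (N A) (string_encode (map (x i) [0..<k]) + 2 ^ k * \<rho>) (psnd s))"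
      if "i < m" for i
    proof -
      let ?l = "pfst s"
      let ?\<rho> = "map (x i) [k..<k + ?l]"
      have len: "length ?\<rho> = ?l" by simp
      \<comment> \<open>The piece of \<open>x i\<close> of length \<open>?l\<close> beyond
        \<open>k\<close> is the required \<open>\<rho>\<close>: its code is at least
        \<open>2 ^ ?l - 1\<close>, hence at least \<open>?l\<close>.\<close>
      have "?l \<le> string_encode ?\<rho>" "string_encode ?\<rho> < 2 * 2 ^ ?l"
        using less_exp[of ?l] string_encode_bounds[of ?\<rho>] unfolding len by linarith+
      moreover have "\<not> enumd e (N A) (string_encode (map (x i) [0..<k]) + 2 ^ k * string_encode ?\<rho>) (psnd s)"
        if "A < m" "i \<in> set_decode A" for A
      proof -
        have "map (x i) [0..<k + ?l] \<in> tree_at e (N A)"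
          using pat that \<open>i < m\<close> unfolding pattern_def concept_at_def paths_def by blast
        then have "\<not> enumd e (N A) (string_encode (map (x i) [0..<k] @ ?\<rho>)) (psnd s)"
          using enumd[of "N A" "map (x i) [0..<k + ?l]"] map_upt_split[of k "k + ?l" "x i"] by simp
        then show ?thesis by (simp add: string_encode_append)
      qed
      ultimately show ?thesis by blast
    qed
    then show ?thesis using t u v string_encode_bounds[of "map (x _) [0..<k]"]
      by (simp add: matrix_def set_decode_def)
  qed
  then show ?thesis by blast
qed

text \<open>The surviving \<open>\<rho>\<close> in \<open>matrix\<close> may change with the stage.
  For fixed \<open>l\<close> there are finitely many candidates, so one survives all stages; letting
  \<open>l\<close> grow gives infinitely many common nodes, and Koenig's lemma yields the point.
  Each point is found separately.\<close>

lemma matrix_imp_pattern: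
  assumes e: "weakly_effective_class e" and w: "\<And>s. matrix e m w s"
  shows "\<exists>x N. pattern (concept_at e) m x N"
proof -
  note tree = weakly_effective_tree(1)[OF e] and enumd = weakly_effective_tree(2)[OF e]
  define k where "k = pfst w"
  define U where "U = cnth (pfst (psnd w))"
  define N where "N = cnth (pfst (psnd (psnd w)))"
  define t where "t = psnd (psnd (psnd w))"
  have M: "2 ^ k \<le> Suc (U i)" "Suc (U i) < 2 * 2 ^ k"
      "\<And>A. A < m \<Longrightarrow> i \<notin> set_decode A \<Longrightarrow> enumd e (N A) (U i) t"
      "\<And>l t'. \<exists>\<rho><2 * 2 ^ l. l \<le> \<rho> \<and>
           (\<forall>A<m. i \<in> set_decode A \<longrightarrow> \<not> enumd e (N A) (U i + 2 ^ k * \<rho>) t')"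
    if "i < m" for i
    using w[of "pr _ _"] that
    unfolding matrix_def Let_def k_def[symmetric] U_def[symmetric] N_def[symmetric] t_def[symmetric]
    by (simp_all add: set_decode_def)
  have "\<exists>x. \<forall>A<m. x \<in> concept_at e (N A) \<longleftrightarrow> i \<in> set_decode A" if "i < m" for i
  proof -
    obtain \<sigma> where \<sigma>: "U i = string_encode \<sigma>" using bij_string_encode by (metis bij_pointE)
    have len: "length \<sigma> = k"
      using M(1,2)[OF that] unfolding \<sigma> by (rule length_eq_if_string_encode_bounds)
    let ?F = "{A. A < m \<and> i \<in> set_decode A}"
    let ?G = "{\<rho>. \<forall>A\<in>?F. \<sigma> @ \<rho> \<in> tree_at e (N A)}"
    have "\<exists>\<rho>\<in>?G. l \<le> string_encode \<rho>" for l
    proof (rule ccontr)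
      assume neg: "\<not> ?thesis"
      let ?R = "\<lambda>\<rho> t'. \<exists>A\<in>?F. enumd e (N A) (U i + 2 ^ k * \<rho>) t'"
      \<comment> \<open>If every candidate were enumerated eventually, a single stage would refute
        all of them, against \<open>matrix\<close> at that stage.\<close>
      have "\<exists>t'. \<forall>\<rho>\<in>{l..<2 * 2 ^ l}. ?R \<rho> t'"
      proof (rule uniform_bound)
        fix \<rho> assume "\<rho> \<in> {l..<2 * 2 ^ l}"
        obtain \<rho>' where \<rho>': "\<rho> = string_encode \<rho>'" using bij_string_encode by (metis bij_pointE)
        then have "\<rho>' \<notin> ?G" using neg \<open>\<rho> \<in> _\<close> by auto
        then obtain A where "A \<in> ?F" "\<sigma> @ \<rho>' \<notin> tree_at e (N A)" by blast
        then show "\<exists>t'. ?R \<rho> t'"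
          using enumd[of "N A" "\<sigma> @ \<rho>'"] by (auto simp: string_encode_append \<rho>' \<sigma> len)
      qed (auto intro: enumd_mono)
      then obtain t' where "\<forall>\<rho>\<in>{l..<2 * 2 ^ l}. ?R \<rho> t'" by blast
      then show False using M(4)[OF that, of l t'] by auto
    qed
    then have "infinite (string_encode ` ?G)"
      unfolding infinite_nat_iff_unbounded_le by blast
    then have "infinite ?G" by blast
    then obtain x where x: "map x [0..<length \<sigma>] = \<sigma>" "\<forall>A\<in>?F. x \<in> paths (tree_at e (N A))"
      using infinite_tree_has_path_through[of ?F "\<lambda>A. tree_at e (N A)" \<sigma>] tree by blast
    have "x \<notin> concept_at e (N A)" if "A < m" "i \<notin> set_decode A" for A
    proof -
      have "\<sigma> \<notin> tree_at e (N A)" using M(3)[OF \<open>i < m\<close> that] enumd[of "N A" \<sigma>] unfolding \<sigma> by blast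
      then show ?thesis using x(1) unfolding concept_at_def paths_def by (metis mem_Collect_eq)
    qed
    then show ?thesis using x(2) unfolding concept_at_def by blast
  qed
  then obtain x where "\<And>i A. i < m \<Longrightarrow> A < m \<Longrightarrow> x i \<in> concept_at e (N A) \<longleftrightarrow> i \<in> set_decode A"
    by metis
  then show ?thesis unfolding pattern_def by blast
qed

section \<open>Shattering and VC dimension\<close>

text \<open>All traces lie in \<open>Pow S\<close>, which has \<open>2 ^ d\<close> elements, so
  reaching this number means obtaining every subset.\<close>

lemma shatters_size_iff:
  "shatters_size C d \<longleftrightarrow> (\<exists>S. finite S \<and> card S = d \<and> Pow S \<subseteq> (\<inter>) S ` C)"
proof -
  have "growth C S = 2 ^ d \<longleftrightarrow> Pow S \<subseteq> (\<inter>) S ` C" if "finite S" "card S = d" for S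
  proof -
    have eq: "{S \<inter> c | c. c \<in> C} = (\<inter>) S ` C" by blast
    have sub: "(\<inter>) S ` C \<subseteq> Pow S" by blast
    have "card ((\<inter>) S ` C) = card (Pow S) \<longleftrightarrow> (\<inter>) S ` C = Pow S"
      using sub that(1) by (metis card_subset_eq finite_Pow_iff)
    then show ?thesis unfolding growth_def eq using sub that by (auto simp: card_Pow)
  qed
  then show ?thesis unfolding shatters_size_def by metis
qed

lemma shatters_size_mono:
  assumes "shatters_size C d" "d' \<le> d" shows "shatters_size C d'"
proof -
  obtain S where S: "finite S" "card S = d" "Pow S \<subseteq> (\<inter>) S ` C"
    using assms(1) unfolding shatters_size_iff by blast
  then obtain S' where S': "S' \<subseteq> S" "card S' = d'" using assms(2) by (metis obtain_subset_with_card_n)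
  have "Pow S' \<subseteq> (\<inter>) S' ` C"
  proof
    fix X assume X: "X \<in> Pow S'"
    then obtain c where "c \<in> C" "X = S \<inter> c" using S(3) S'(1) by blast
    moreover from this have "X = S' \<inter> c" using X S'(1) by blast
    ultimately show "X \<in> (\<inter>) S' ` C" by blast
  qed
  moreover have "finite S'" using S(1) S'(1) finite_subset by blast
  ultimately show ?thesis using S'(2) unfolding shatters_size_iff by blast
qed

text \<open>A nonempty class shatters the empty set, so without a largest shattered size there are
  arbitrarily large ones. The empty class shatters no size, yet has \<open>vc_dim\<close> equal to
  \<infinity>.\<close>

lemma vc_dim_infinite_iff:
  assumes "C \<noteq> {}" shows "vc_dim C = \<infinity> \<longleftrightarrow> (\<forall>d. shatters_size C d)"
proof
  assume "vc_dim C = \<infinity>"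
  then have no_max: "\<not> (\<exists>d. shatters_size C d \<and> (\<forall>d'. shatters_size C d' \<longrightarrow> d' \<le> d))"
    unfolding vc_dim_def by (metis enat.distinct(1))
  have "\<exists>d'\<ge>d. shatters_size C d'" for d
  proof (induction d)
    case 0
    have "shatters_size C 0" unfolding shatters_size_iff using assms by (intro exI[of _ "{}"]) auto
    then show ?case by blast
  next
    case (Suc d)
    then show ?case using no_max by (metis Suc_leI le_less_trans not_le)
  qed
  then show "\<forall>d. shatters_size C d" using shatters_size_mono by blast
next
  assume "\<forall>d. shatters_size C d"
  then show "vc_dim C = \<infinity>" unfolding vc_dim_def by (metis Suc_n_not_le_n)
qed

lemma vc_dim_finite_class:
  assumes "finite C" "C \<noteq> {}" shows "vc_dim C \<noteq> \<infinity>"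
proof
  assume "vc_dim C = \<infinity>"
  then have "shatters_size C (card C)" using vc_dim_infinite_iff assms(2) by blast
  then obtain S where S: "finite S" "card S = card C" "Pow S \<subseteq> (\<inter>) S ` C"
    unfolding shatters_size_iff by blast
  have "card (Pow S) \<le> card C" using surj_card_le[OF assms(1) S(3)] .
  then show False using S(1,2) less_exp[of "card C"] by (simp add: card_Pow)
qed

lemma vc_dim_infinite_iff_pattern:
  "vc_dim (range c) = \<infinity> \<longleftrightarrow> (\<forall>m. \<exists>x N. pattern c m x N)"
proof -
  have "\<exists>x N. pattern c m x N" if sh: "shatters_size (range c) m" for m
  proof -
    obtain S where S: "finite S" "card S = m" "Pow S \<subseteq> (\<inter>) S ` range c"
      using sh unfolding shatters_size_iff by blast
    obtain x where x: "bij_betw x {..<m} S"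
      using S(1,2) by (metis ex_bij_betw_nat_finite lessThan_atLeast0)
    have "\<exists>n. x ` (set_decode A \<inter> {..<m}) = S \<inter> c n" for A
    proof -
      have "x ` (set_decode A \<inter> {..<m}) \<in> Pow S" using x unfolding bij_betw_def by blast
      from subsetD[OF S(3) this] show ?thesis by auto
    qed
    then obtain N where N: "\<And>A. x ` (set_decode A \<inter> {..<m}) = S \<inter> c (N A)" by metis
    have "x i \<in> c (N A) \<longleftrightarrow> i \<in> set_decode A" if "i < m" for i A
    proof -
      have "x i \<in> c (N A) \<longleftrightarrow> x i \<in> x ` (set_decode A \<inter> {..<m})"
        using x that unfolding N bij_betw_def by blast
      also have "\<dots> \<longleftrightarrow> i \<in> set_decode A"
        using x that unfolding bij_betw_def inj_on_def by blast
      finally show ?thesis .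
    qed
    then show ?thesis unfolding pattern_def by blast
  qed
  moreover have "shatters_size (range c) d" if pat: "\<And>m. \<exists>x N. pattern c m x N" for d
  proof -
    \<comment> \<open>\<open>m\<close> exceeds \<open>d\<close> and the codes of all subsets of
      \<open>{..<d}\<close>, so the pattern prescribes each of these subsets.\<close>
    define M where "M = Max (set_encode ` Pow {..<d})"
    define m where "m = Suc M + d"
    have m: "set_encode B < m" if "B \<subseteq> {..<d}" for B
    proof -
      have "set_encode B \<le> M" unfolding M_def using that by (intro Max_ge) auto
      then show ?thesis by (simp add: m_def)
    qed
    obtain x N where xN: "pattern c m x N" using pat by blast
    have x: "x i \<in> c (N (set_encode B)) \<longleftrightarrow> i \<in> B" if "i < d" "B \<subseteq> {..<d}" for i B
    proof -
      have "finite B" using that(2) finite_subset by blast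
      then show ?thesis using xN m[OF that(2)] that(1) by (simp add: pattern_def m_def)
    qed
    \<comment> \<open>The concept assigned to \<open>{i}\<close> separates \<open>x i\<close> from
      the other points.\<close>
    have inj: "inj_on x {..<d}"
      by (rule inj_onI) (metis lessThan_iff singletonD singletonI subsetI x)
    have "Pow (x ` {..<d}) \<subseteq> (\<inter>) (x ` {..<d}) ` range c"
    proof
      fix X assume "X \<in> Pow (x ` {..<d})"
      then obtain B where B: "B \<subseteq> {..<d}" "X = x ` B" by (auto simp: subset_image_iff)
      then have "X = x ` {..<d} \<inter> c (N (set_encode B))" using x by auto
      then show "X \<in> (\<inter>) (x ` {..<d}) ` range c" by blast
    qed
    moreover have "card (x ` {..<d}) = d" using inj by (simp add: card_image)
    ultimately show ?thesis unfolding shatters_size_iff by blast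
  qed
  ultimately show ?thesis by (subst vc_dim_infinite_iff) auto
qed

section \<open>Normal form of \<open>\<Pi>\<^sub>3\<close> sets\<close>

text \<open>Three levels of \<open>Sigma0\<close> are unfolded, with a complement at each. Pairs
  nest to the left because each level adds its variable as a second component.\<close>

lemma Pi0_3_iff:
  "S \<in> Pi0 3 \<longleftrightarrow>
     (\<exists>Q. decidable Q \<and> S = {x. \<forall>a. \<exists>b. \<forall>c. Q (pr (pr (pr x a) b) c)})"
proof
  assume "S \<in> Pi0 3"
  then have "- S \<in> Sigma0 (Suc (Suc (Suc 0)))" by (simp only: Pi0_def numeral_3_eq_3 mem_Collect_eq)
  then obtain B1 where B1: "- B1 \<in> Sigma0 (Suc (Suc 0))" "- S = {x. \<exists>y. pr x y \<in> B1}"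
    by (subst (asm) Sigma0.simps(2)) blast
  then obtain B2 where B2: "- B2 \<in> Sigma0 (Suc 0)" "- B1 = {x. \<exists>y. pr x y \<in> B2}"
    by (subst (asm) Sigma0.simps(2)) blast
  then obtain B3 where B3: "- B3 \<in> Sigma0 0" "- B2 = {x. \<exists>y. pr x y \<in> B3}"
    by (subst (asm) Sigma0.simps(2)) blast
  have "x \<in> S \<longleftrightarrow> (\<forall>a. pr x a \<in> - B1)" for x using B1(2) by blast
  moreover have "x \<in> - B1 \<longleftrightarrow> (\<exists>b. pr x b \<in> B2)" for x using B2(2) by blast
  moreover have "x \<in> B2 \<longleftrightarrow> (\<forall>c. pr x c \<in> - B3)" for x using B3(2) by blast
  ultimately have "S = {x. \<forall>a. \<exists>b. \<forall>c. pr (pr (pr x a) b) c \<in> - B3}"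
    by (intro set_eqI) simp
  moreover have "decidable (\<lambda>x. x \<in> - B3)" using B3(1) by (simp add: decidable_def)
  ultimately show "\<exists>Q. decidable Q \<and> S = {x. \<forall>a. \<exists>b. \<forall>c. Q (pr (pr (pr x a) b) c)}"
    by (intro exI[of _ "\<lambda>x. x \<in> - B3"]) blast
next
  assume "\<exists>Q. decidable Q \<and> S = {x. \<forall>a. \<exists>b. \<forall>c. Q (pr (pr (pr x a) b) c)}"
  then obtain Q where Q: "decidable Q" "S = {x. \<forall>a. \<exists>b. \<forall>c. Q (pr (pr (pr x a) b) c)}" by blast
  have "Collect Q \<in> Sigma0 0" using Q(1) by (simp add: decidable_def)
  then have "- {x. \<forall>c. Q (pr x c)} \<in> Sigma0 1"
    by (simp add: exI[of _ "- Collect Q"] Collect_neg_eq[symmetric])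
  moreover have "- {x. \<forall>c. Q (pr x c)} \<in> Sigma0 1 \<Longrightarrow> {x. \<exists>b. \<forall>c. Q (pr (pr x b) c)} \<in> Sigma0 2"
    unfolding numeral_2_eq_2 One_nat_def
    by (subst Sigma0.simps(2)) (rule CollectI, rule exI[of _ "{x. \<forall>c. Q (pr x c)}"], simp)
  moreover have "{x. \<exists>b. \<forall>c. Q (pr (pr x b) c)} \<in> Sigma0 2 \<Longrightarrow> - S \<in> Sigma0 3"
    unfolding numeral_3_eq_3 numeral_2_eq_2 Q(2)
    by (subst Sigma0.simps(2))
       (rule CollectI, rule exI[of _ "- {x. \<exists>b. \<forall>c. Q (pr (pr x b) c)}"], rule conjI,
         simp only: double_compl, rule set_eqI, simp)
  ultimately show "S \<in> Pi0 3" unfolding Pi0_def by blast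
qed

text \<open>\<open>R\<close> is defined for all \<open>e\<close> but is correct only on weakly
  effective classes; this is what membership within \<open>L\<close> asks for.\<close>

lemma infinite_vc_dim_Pi0_3:
  "\<exists>R\<in>Pi0 3. \<forall>e. weakly_effective_class e \<longrightarrow> (e \<in> R \<longleftrightarrow> vc_dim (concept_class e) = \<infinity>)"
proof
  let ?R = "{e. \<forall>m. \<exists>w. \<forall>s. matrix e m w s}"
  show "?R \<in> Pi0 3"
    unfolding Pi0_3_iff using decidable_matrix by (intro exI conjI) (assumption, simp)
  show "\<forall>e. weakly_effective_class e \<longrightarrow> (e \<in> ?R \<longleftrightarrow> vc_dim (concept_class e) = \<infinity>)"
    unfolding concept_class_def vc_dim_infinite_iff_pattern
    using pattern_imp_matrix matrix_imp_pattern by blast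
qed

section \<open>Hardness\<close>

primrec const_prog :: "nat \<Rightarrow> prog" where
  "const_prog 0 = Zero"
| "const_prog (Suc n) = Comp Succ (const_prog n)"

lemma eval_const_prog [simp]: "eval (const_prog n) x = Some n"
  by (induction n) simp_all

lemma computable_const_prog: "computable (\<lambda>x. prog_encode (const_prog x))"
proof -
  have "prog_encode (const_prog x) = rec_nat 0 (\<lambda>k v. 4 * pr 1 v + 5) x" for x
    by (induction x) simp_all
  then show ?thesis by (simp only:) (intro comp)
qed

text \<open>\<open>x\<close> is hardwired through \<open>const_prog x\<close>, and
  \<open>Pair Fst Snd\<close> passes \<open>y\<close> on unchanged.\<close>

lemma smn:
  assumes "computable h"
  shows "\<exists>s. computable s \<and> (\<forall>x y. phi (s x) y = Some (h (pr x y)))"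
proof -
  obtain q where q: "\<And>z. eval q z = Some (h z)" using assms unfolding computable_iff by blast
  define s where "s x = prog_encode (Comp q (Pair (const_prog x) (Pair Fst Snd)))" for x
  have "computable s"
    unfolding s_def prog_encode.simps by (intro comp computable_const_prog)
  moreover have "phi (s x) y = Some (h (pr x y))" for x y by (simp add: s_def q del: prog_encode.simps)
  ultimately show ?thesis by blast
qed

section \<open>Concepts restricting the place of the first one\<close>

text \<open>
  The concepts are sets \<open>{x. if i is the least place with x i, then i \<in> set_decode A}\<close>. The predicate
  \<open>near\<close> serves both purposes: for \<open>p = 0\<close> it defines the tree, and for \<open>p / q\<close> a radius it decides
  whether the ball around \<open>\<sigma>\<close> meets the concept.
\<close>

primrec near :: "nat \<Rightarrow> bool list \<Rightarrow> nat \<Rightarrow> nat \<Rightarrow> bool" where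
  "near q [] A p = True"
| "near q (b # \<sigma>) A p = (if b then odd A \<or> q < 2 * p else near q \<sigma> (A div 2) (2 * p))"

text \<open>Each \<open>False\<close> passed halves \<open>A\<close> and doubles \<open>p\<close>,
  so at place \<open>i\<close> the tests concern bit \<open>i\<close> of the original
  \<open>A\<close> and the inequality \<open>q < 2 ^ Suc i * p\<close>. The latter is false for
  \<open>p = 0\<close>.\<close>

lemma near_iff:
  "near q \<sigma> A p \<longleftrightarrow>
     (\<forall>i<length \<sigma>. \<sigma> ! i \<and> (\<forall>j<i. \<not> \<sigma> ! j) \<longrightarrow> i \<in> set_decode A \<or> q < 2 ^ Suc i * p)"
proof (induction \<sigma> arbitrary: A p)
  case (Cons b \<sigma>)
  show ?case
  proof (cases b)
    case True
    then show ?thesis by (auto simp: All_less_Suc2)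
  next
    case False
    then show ?thesis
      by (simp add: Cons.IH All_less_Suc2 set_decode_Suc mult.assoc mult.left_commute[of 2])
  qed
qed simp

text \<open>One round of \<open>near\<close> on codes: an odd code starts with \<open>False\<close>,
  which is removed. The empty string and strings starting with \<open>True\<close> are fixed, so
  surplus rounds do no harm.\<close>

definition strip :: "nat \<Rightarrow> nat" where
  "strip v = (if odd (pfst v) then pr (pfst v div 2) (pr (pfst (psnd v) div 2) (2 * psnd (psnd v))) else v)"

definition near_test :: "nat \<Rightarrow> nat \<Rightarrow> bool" where
  "near_test q v \<longleftrightarrow> pfst v = 0 \<or> odd (pfst (psnd v)) \<or> q < 2 * psnd (psnd v)"

text \<open>The code \<open>s\<close> doubles as the number of rounds, being at least the length of
  its string.\<close>

definition near_code :: "nat \<Rightarrow> nat \<Rightarrow> nat \<Rightarrow> nat \<Rightarrow> bool" where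
  "near_code q s A p \<longleftrightarrow> near_test q ((strip ^^ s) (pr s (pr A p)))"

lemma near_test_strip:
  "length \<sigma> \<le> n \<Longrightarrow> near_test q ((strip ^^ n) (pr (string_encode \<sigma>) (pr A p))) = near q \<sigma> A p"
proof (induction \<sigma> arbitrary: n A p)
  case Nil
  have "(strip ^^ n) (pr 0 (pr A p)) = pr 0 (pr A p)" by (induction n) (simp_all add: strip_def)
  then show ?case by (simp add: near_test_def)
next
  case (Cons b \<sigma>)
  show ?case
  proof (cases b)
    case True
    have "(strip ^^ n) (pr (2 * k + 2) (pr A p)) = pr (2 * k + 2) (pr A p)" for k
      by (induction n) (simp_all add: strip_def)
    then show ?thesis using True by (simp add: near_test_def)
  next
    case False
    obtain n' where n: "n = Suc n'" "length \<sigma> \<le> n'" using Cons.prems by (cases n) auto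
    have "strip (pr (string_encode (b # \<sigma>)) (pr A p)) = pr (string_encode \<sigma>) (pr (A div 2) (2 * p))"
      using False by (simp add: strip_def)
    then show ?thesis using Cons.IH[OF n(2)] False
      unfolding n(1) funpow_Suc_right comp_apply by simp
  qed
qed

lemma near_code_string_encode: "near_code q (string_encode \<sigma>) A p = near q \<sigma> A p"
proof -
  have "length \<sigma> \<le> string_encode \<sigma>"
    using less_exp[of "length \<sigma>"] string_encode_bounds(1)[of \<sigma>] by linarith
  then show ?thesis unfolding near_code_def by (rule near_test_strip)
qed

lemma decidable_near_code [comp]:
  assumes "computable f" "computable g" "computable h" "computable k"
  shows "decidable (\<lambda>x. near_code (f x) (g x) (h x) (k x))"
proof -
  have "(strip ^^ n) v = rec_nat v (\<lambda>k v. strip v) n" for n v by (induction n) simp_all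
  then show ?thesis
    unfolding near_code_def near_test_def by (simp only: strip_def) (intro comp assms)
qed

definition first_in :: "nat \<Rightarrow> (nat \<Rightarrow> bool) set" where
  "first_in A = {x. \<forall>i. x i \<and> (\<forall>j<i. \<not> x j) \<longrightarrow> i \<in> set_decode A}"

lemma is_tree_near: "is_tree {\<sigma>. near 0 \<sigma> A 0}"
  unfolding is_tree_def near_iff by (auto simp: nth_append)

lemma paths_near: "paths {\<sigma>. near 0 \<sigma> A 0} = first_in A"
proof -
  have eq: "near 0 (map x [0..<n]) A 0 \<longleftrightarrow> (\<forall>i<n. x i \<and> (\<forall>j<i. \<not> x j) \<longrightarrow> i \<in> set_decode A)" for x n
  proof -
    have "(\<forall>j<i. \<not> map x [0..<n] ! j) \<longleftrightarrow> (\<forall>j<i. \<not> x j)" if "i < n" for i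
      using that by (metis add_0 less_trans nth_map_upt diff_zero)
    then show ?thesis by (auto simp: near_iff)
  qed
  show ?thesis unfolding paths_def first_in_def mem_Collect_eq eq by blast
qed

lemma effective_concept_empty: "effective_concept {}"
proof -
  obtain e where "\<And>x. phi e x = Some 0" using computable_const[of 0] unfolding computable_def by blast
  then show ?thesis unfolding effective_concept_def by (intro exI[of _ "\<lambda>_ _. 0"]) auto
qed

text \<open>For an integer \<open>n\<close>, \<open>n < \<lceil>t\<rceil>\<close> is the same as
  \<open>n < t\<close>. Applied to \<open>n = - (j + 1)\<close> this removes the ceiling, and
  exponentiation then removes the logarithm.\<close>

lemma ceiling_log_le_iff:
  assumes "0 < (r::rat)" shows "- \<lceil>log 2 (of_rat r)\<rceil> \<le> int j \<longleftrightarrow> 1 < 2 ^ Suc j * r"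
proof -
  have "0 < (of_rat r :: real)" using assms by simp
  have "- \<lceil>log 2 (of_rat r)\<rceil> \<le> int j \<longleftrightarrow> - int (Suc j) < \<lceil>log 2 (of_rat r)\<rceil>" by auto
  also have "\<dots> \<longleftrightarrow> of_int (- int (Suc j)) < log 2 (of_rat r)" by (rule less_ceiling_iff)
  also have "\<dots> \<longleftrightarrow> 2 powr (- real (Suc j)) < (of_rat r :: real)"
    using \<open>0 < of_rat r\<close> by (subst less_log_iff) auto
  also have "2 powr (- real (Suc j)) = inverse (2 ^ Suc j :: real)"
    by (simp only: powr_minus powr_realpow zero_less_numeral)
  also have "inverse (2 ^ Suc j) < (of_rat r :: real) \<longleftrightarrow> 1 < 2 ^ Suc j * (of_rat r :: real)"
    by (simp add: field_simps)
  also have "\<dots> \<longleftrightarrow> of_rat 1 < (of_rat (2 ^ Suc j * r) :: real)"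
    by (simp add: of_rat_mult of_rat_power)
  also have "\<dots> \<longleftrightarrow> 1 < 2 ^ Suc j * r" by (rule of_rat_less)
  finally show ?thesis .
qed

lemma less_mult_quotient_of:
  assumes "0 < r" "quotient_of r = (p, q)"
  shows "1 < 2 ^ k * r \<longleftrightarrow> int_encode q < 2 ^ k * int_encode p"
proof -
  have q: "0 < q" using assms(2) quotient_of_denom_pos by blast
  have r: "r = of_int p / of_int q" using assms(2) quotient_of_div by blast
  have p: "0 < p" using assms(1) q unfolding r by (simp add: zero_less_divide_iff)
  have "1 < 2 ^ k * r \<longleftrightarrow> (of_int q :: rat) < of_int (2 ^ k * p)" using q unfolding r by (simp add: field_simps)
  also have "\<dots> \<longleftrightarrow> q < 2 ^ k * p" by (rule of_int_less_iff)
  also have "\<dots> \<longleftrightarrow> nat q < nat (2 ^ k * p)"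
    using q by (simp only: nat_less_eq_zless order_less_imp_le)
  also have "nat (2 ^ k * p) = 2 ^ k * nat p"
    by (simp add: nat_mult_distrib nat_power_eq)
  \<comment> \<open>On nonnegative integers \<open>int_encode\<close> is doubling and the factor
    cancels, so codes can be compared directly.\<close>
  also have "nat q < 2 ^ k * nat p \<longleftrightarrow> int_encode q < 2 ^ k * int_encode p"
    using p q by (simp add: int_encode_def sum_encode_def)
  finally show ?thesis .
qed

text \<open>Only the least \<open>i\<close> with \<open>\<sigma> ! i\<close> matters. If
  \<open>A\<close> does not allow \<open>i\<close>, a point of the ball in the concept must leave
  \<open>\<sigma>\<close> at \<open>i\<close> or earlier. If the radius permits this, it also
  permits leaving at \<open>i\<close>, and the zero sequence will do.\<close>

lemma effective_concept_first_in: "effective_concept (first_in A)"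
proof -
  define f :: "bool list \<Rightarrow> rat \<Rightarrow> nat" where
    "f \<sigma> r = of_bool (near (int_encode (snd (quotient_of r))) \<sigma> A (int_encode (fst (quotient_of r))))" for \<sigma> r
  have "computable (\<lambda>z. of_bool (near_code (psnd (psnd z)) (pfst z) A (pfst (psnd z))))"
    unfolding decidable_def[symmetric] by (intro comp)
  then obtain e where e: "\<And>z. phi e z = Some (of_bool (near_code (psnd (psnd z)) (pfst z) A (pfst (psnd z))))"
    unfolding computable_def by blast
  have "phi e (pr (string_encode \<sigma>) (rat_encode r)) = Some (f \<sigma> r)" for \<sigma> r
    by (simp add: e f_def rat_encode_def near_code_string_encode)
  moreover have "f \<sigma> r \<in> {0, 1}" for \<sigma> r by (simp add: f_def)
  moreover have "f \<sigma> r = 1" if r: "0 < r" and ball: "cantor_ball r \<sigma> \<inter> first_in A \<noteq> {}" for \<sigma> r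
  proof -
    obtain p q where pq: "quotient_of r = (p, q)" by fastforce
    obtain x where x: "x \<in> cantor_ball r \<sigma>" "x \<in> first_in A" using ball by blast
    have "near (int_encode q) \<sigma> A (int_encode p)"
      unfolding near_iff
    proof (intro allI impI)
      fix i assume i: "i < length \<sigma>" "\<sigma> ! i \<and> (\<forall>j<i. \<not> \<sigma> ! j)"
      show "i \<in> set_decode A \<or> int_encode q < 2 ^ Suc i * int_encode p"
      proof (cases "\<forall>j\<le>i. x j = \<sigma> ! j")
        case True
        then show ?thesis using x(2) i unfolding first_in_def by simp
      next
        case False
        then obtain j' where "j' \<le> i" "x j' \<noteq> \<sigma> ! j'" by blast
        then obtain j where j: "\<forall>i<j. x i = \<sigma> ! i" "x j \<noteq> \<sigma> ! j" "- \<lceil>log 2 (of_rat r)\<rceil> \<le> int j"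
          using x(1) i(1) unfolding cantor_ball_def by auto
        then have "j \<le> i" using \<open>j' \<le> i\<close> \<open>x j' \<noteq> \<sigma> ! j'\<close> by (meson le_less_trans not_le)
        then have "- \<lceil>log 2 (of_rat r)\<rceil> \<le> int i" using j(3) by linarith
        then show ?thesis
          using ceiling_log_le_iff[OF r] less_mult_quotient_of[OF r pq] by blast
      qed
    qed
    then show ?thesis by (simp add: f_def pq)
  qed
  moreover have "f \<sigma> r = 0" if r: "0 < r" and ball: "cantor_ball (2 * r) \<sigma> \<inter> first_in A = {}" for \<sigma> r
  proof -
    obtain p q where pq: "quotient_of r = (p, q)" by fastforce
    have "\<not> near (int_encode q) \<sigma> A (int_encode p)"
    proof
      assume near: "near (int_encode q) \<sigma> A (int_encode p)"
      \<comment> \<open>\<open>?x\<close> continues \<open>\<sigma>\<close> by zeros. If it misses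
        the concept, the zero sequence takes over: it has no first one and so lies in every
        \<open>first_in\<close>.\<close>
      let ?z = "\<lambda>i. False" and ?x = "\<lambda>i. i < length \<sigma> \<and> \<sigma> ! i"
      have z: "?z \<in> first_in A" by (simp add: first_in_def)
      show False
      proof (cases "?x \<in> first_in A")
        case True
        moreover have "?x \<in> cantor_ball (2 * r) \<sigma>" by (simp add: cantor_ball_def)
        ultimately show False using ball by blast
      next
        case False
        then obtain i where i: "i < length \<sigma>" "\<sigma> ! i" "\<forall>j<i. \<not> \<sigma> ! j" "i \<notin> set_decode A"
          by (auto simp: first_in_def)
        then have "1 < 2 ^ Suc i * r" using near less_mult_quotient_of[OF r pq]
          unfolding near_iff by blast
        also have "\<dots> \<le> 2 ^ Suc i * (2 * r)" using r by simp
        finally have "- \<lceil>log 2 (of_rat (2 * r))\<rceil> \<le> int i"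
          using r ceiling_log_le_iff[of "2 * r" i] by simp
        then have "?z \<in> cantor_ball (2 * r) \<sigma>" unfolding cantor_ball_def using i by auto
        then show False using z ball by blast
      qed
    qed
    then show ?thesis by (simp add: f_def pq)
  qed
  ultimately show ?thesis unfolding effective_concept_def by (intro exI[of _ f]) blast
qed

section \<open>The hard family of classes\<close>

text \<open>Here \<open>n\<close> is a pair \<open>(A, w)\<close> and \<open>z\<close> a pair \<open>(a, c)\<close>, which refutes the candidate \<open>b\<close> for \<open>a\<close> in \<open>w\<close>.\<close>

definition dies :: "(nat \<Rightarrow> bool) \<Rightarrow> nat \<Rightarrow> nat \<Rightarrow> nat \<Rightarrow> bool" where
  "dies Q x n z \<longleftrightarrow> pfst z \<le> pfst n \<and>
     \<not> Q (pr (pr (pr x (pfst z)) (cnth (psnd n) (pfst z))) (psnd z))"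

text \<open>
  The factor 2 keeps the string \<open>[True]\<close>, with code 2, outside every tree, so that the total functions
  which enumerate the complements can use it as a default output.
\<close>

definition hard_tree :: "(nat \<Rightarrow> bool) \<Rightarrow> nat \<Rightarrow> nat \<Rightarrow> bool list set" where
  "hard_tree Q x n = {\<sigma>. near 0 \<sigma> (2 * pfst n) 0 \<and> (\<forall>z. \<not> dies Q x n z)}"

text \<open>A refutation does not depend on the node, so a single one removes the whole
  tree.\<close>

lemma paths_hard_tree:
  "paths (hard_tree Q x n) = (if \<exists>z. dies Q x n z then {} else first_in (2 * pfst n))"
proof (cases "\<exists>z. dies Q x n z")
  case True
  then have "hard_tree Q x n = {}" by (auto simp: hard_tree_def)
  then show ?thesis using True by (simp add: paths_def)
next
  case False
  then have "hard_tree Q x n = {\<sigma>. near 0 \<sigma> (2 * pfst n) 0}" by (auto simp: hard_tree_def)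
  then show ?thesis using False by (simp add: paths_near)
qed

text \<open>Witnesses for all \<open>a \<le> A\<close> are listed in one \<open>w\<close>;
  conversely, entry \<open>a\<close> of a list surviving for \<open>A = a\<close> is a witness for
  \<open>a\<close>.\<close>

lemma all_alive_iff:
  "(\<forall>a. \<exists>b. \<forall>c. Q (pr (pr (pr x a) b) c)) \<longleftrightarrow> (\<forall>A. \<exists>w. \<forall>z. \<not> dies Q x (pr A w) z)"
proof
  assume "\<forall>a. \<exists>b. \<forall>c. Q (pr (pr (pr x a) b) c)"
  then obtain b where b: "\<And>a c. Q (pr (pr (pr x a) (b a)) c)" by metis
  show "\<forall>A. \<exists>w. \<forall>z. \<not> dies Q x (pr A w) z"
  proof
    fix A
    obtain w where w: "\<forall>i<Suc A. cnth w i = b i" using ex_cnth[of "Suc A" b] by blast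
    have "\<not> dies Q x (pr A w) z" for z using w b by (auto simp: dies_def)
    then show "\<exists>w. \<forall>z. \<not> dies Q x (pr A w) z" by blast
  qed
next
  assume alive: "\<forall>A. \<exists>w. \<forall>z. \<not> dies Q x (pr A w) z"
  show "\<forall>a. \<exists>b. \<forall>c. Q (pr (pr (pr x a) b) c)"
  proof
    fix a
    obtain w where "\<And>z. \<not> dies Q x (pr a w) z" using alive by blast
    from this[of "pr a _"] have "Q (pr (pr (pr x a) (cnth w a)) c)" for c by (simp add: dies_def)
    then show "\<exists>b. \<forall>c. Q (pr (pr (pr x a) b) c)" by blast
  qed
qed

lemma dies_antimono: "dies Q x (pr A w) z \<Longrightarrow> A \<le> A' \<Longrightarrow> dies Q x (pr A' w) z"
  by (simp add: dies_def)

lemma vc_dim_hard_class: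
  "vc_dim (range (\<lambda>n. paths (hard_tree Q x n))) = \<infinity> \<longleftrightarrow>
     (\<forall>a. \<exists>b. \<forall>c. Q (pr (pr (pr x a) b) c))"
  unfolding all_alive_iff
proof
  assume "\<forall>A. \<exists>w. \<forall>z. \<not> dies Q x (pr A w) z"
  then obtain w where w: "\<And>A z. \<not> dies Q x (pr A (w A)) z" by metis
  \<comment> \<open>Point \<open>i\<close> has its only one at place \<open>Suc i\<close>; the shift
    matches the factor 2 in \<open>hard_tree\<close>.\<close>
  have "pattern (\<lambda>n. paths (hard_tree Q x n)) m (\<lambda>i j. j = Suc i) (\<lambda>A. pr A (w A))" for m
    using w by (auto simp: pattern_def paths_hard_tree first_in_def set_decode_def)
  then show "vc_dim (range (\<lambda>n. paths (hard_tree Q x n))) = \<infinity>"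
    unfolding vc_dim_infinite_iff_pattern by blast
next
  assume inf: "vc_dim (range (\<lambda>n. paths (hard_tree Q x n))) = \<infinity>"
  show "\<forall>A. \<exists>w. \<forall>z. \<not> dies Q x (pr A w) z"
  proof (rule ccontr)
    assume "\<not> ?thesis"
    then obtain A where A: "\<And>w. \<exists>z. dies Q x (pr A w) z" by blast
    \<comment> \<open>All codes from \<open>A\<close> on inherit the unmet requirement. A surviving
      concept depends on \<open>pfst n\<close> alone, so the many lists \<open>w\<close> add no
      further concepts.\<close>
    have "paths (hard_tree Q x n) \<in> insert {} ((\<lambda>A. first_in (2 * A)) ` {..<A})" for n
    proof (cases "pfst n < A")
      case False
      then have "\<exists>z. dies Q x n z" using A[of "psnd n"] dies_antimono[of Q x A "psnd n" _ "pfst n"] by auto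
      then show ?thesis by (simp add: paths_hard_tree)
    qed (auto simp: paths_hard_tree)
    then have "range (\<lambda>n. paths (hard_tree Q x n)) \<subseteq> insert {} ((\<lambda>A. first_in (2 * A)) ` {..<A})"
      by blast
    then have "finite (range (\<lambda>n. paths (hard_tree Q x n)))" by (rule finite_subset) simp
    then show False using vc_dim_finite_class inf by blast
  qed
qed

text \<open>Two uses of \<open>smn\<close>: the first turns \<open>(x, n)\<close> into a machine
  enumerating the complement of the tree, the second turns \<open>x\<close> into an index of the
  function from \<open>n\<close> to that machine.\<close>

lemma hard_trees_uniform:
  assumes Q: "decidable Q"
  shows "\<exists>f. computable f \<and> (\<forall>x n. \<exists>i. phi (f x) n = Some i \<and> pi01_index i (hard_tree Q x n))"
proof -
  \<comment> \<open>On input \<open>pr (pr x n) (pr c z)\<close> the code \<open>c\<close> is put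
    out if its string fails \<open>near\<close> or \<open>z\<close> is a refutation; otherwise the
    default 2 is.\<close>
  define h where "h z = (if \<not> near_code 0 (pfst (psnd z)) (2 * pfst (psnd (pfst z))) 0 \<or>
      dies Q (pfst (pfst z)) (psnd (pfst z)) (psnd (psnd z)) then pfst (psnd z) else 2)" for z
  have Q': "decidable (\<lambda>x. Q (g x))" if "computable g" for g
    using computable_compose[OF Q[unfolded decidable_def] that] unfolding decidable_def .
  have "computable h" unfolding h_def dies_def by (intro comp Q')
  then obtain s1 where s1: "computable s1" "\<And>u y. phi (s1 u) y = Some (h (pr u y))"
    using smn by blast
  then obtain s2 where s2: "computable s2" "\<And>x n. phi (s2 x) n = Some (s1 (pr x n))"
    using smn by blast
  have "pi01_index (s1 (pr x n)) (hard_tree Q x n)" for x n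
  proof -
    have "is_tree (hard_tree Q x n)"
      using is_tree_near[of "2 * pfst n"] unfolding is_tree_def hard_tree_def by blast
    moreover have "string_encode ` (- hard_tree Q x n) = ran (phi (s1 (pr x n)))"
    proof (intro set_eqI iffI)
      fix c assume "c \<in> string_encode ` (- hard_tree Q x n)"
      then obtain \<sigma> where \<sigma>: "c = string_encode \<sigma>" "\<sigma> \<notin> hard_tree Q x n" by blast
      then obtain z where "\<not> near 0 \<sigma> (2 * pfst n) 0 \<or> dies Q x n z"
        unfolding hard_tree_def by blast
      then have "phi (s1 (pr x n)) (pr c z) = Some c"
        by (simp add: s1(2) h_def \<sigma>(1) near_code_string_encode)
      then show "c \<in> ran (phi (s1 (pr x n)))" by (rule ranI)
    next
      fix c assume "c \<in> ran (phi (s1 (pr x n)))"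
      then obtain y where y: "c = h (pr (pr x n) y)" by (auto simp: ran_def s1(2))
      obtain \<sigma> where \<sigma>: "pfst y = string_encode \<sigma>" using bij_string_encode by (metis bij_pointE)
      have "[True] \<notin> hard_tree Q x n" by (simp add: hard_tree_def)
      moreover have "string_encode [True] = 2" by simp
      ultimately have "2 \<in> string_encode ` (- hard_tree Q x n)" by (metis ComplI imageI)
      moreover have "string_encode \<sigma> \<in> string_encode ` (- hard_tree Q x n)"
        if "\<not> near 0 \<sigma> (2 * pfst n) 0 \<or> dies Q x n (psnd y)"
        using that by (intro imageI) (auto simp: hard_tree_def)
      ultimately show "c \<in> string_encode ` (- hard_tree Q x n)"
        by (auto simp: y h_def \<sigma> near_code_string_encode)
    qed
    ultimately show ?thesis unfolding pi01_index_def by blast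
  qed
  then show ?thesis using s2 by blast
qed

lemma infinite_vc_dim_hard:
  assumes "S \<in> Pi0 3"
  shows "\<exists>f. computable f \<and> (\<forall>x. effective_class (f x)) \<and>
    (\<forall>x. x \<in> S \<longleftrightarrow> vc_dim (concept_class (f x)) = \<infinity>)"
proof -
  obtain Q where Q: "decidable Q" "S = {x. \<forall>a. \<exists>b. \<forall>c. Q (pr (pr (pr x a) b) c)}"
    using assms unfolding Pi0_3_iff by blast
  obtain f where f: "computable f"
      "\<And>x n. \<exists>i. phi (f x) n = Some i \<and> pi01_index i (hard_tree Q x n)"
    using hard_trees_uniform[OF Q(1)] by blast
  have tree: "concept_at (f x) n = paths (hard_tree Q x n)" for x n
    using f(2)[of x n] tree_at_eq unfolding concept_at_def by metis
  have "weakly_effective_class (f x)" for x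
    using f(2) unfolding weakly_effective_class_def by meson
  \<comment> \<open>Effectiveness is asked of each concept separately, so no algorithm has to decide
    whether the concept is empty.\<close>
  moreover have "effective_concept (concept_at (f x) n)" for x n
    unfolding tree paths_hard_tree by (simp add: effective_concept_empty effective_concept_first_in)
  ultimately have "effective_class (f x)" for x unfolding effective_class_def by blast
  moreover have "concept_class (f x) = range (\<lambda>n. paths (hard_tree Q x n))" for x
    unfolding concept_class_def tree[symmetric] by simp
  ultimately show ?thesis using f(1) vc_dim_hard_class Q(2) by auto
qed

theorem mainTheorem6:
  fixes L :: "nat set"
  assumes "L = {e. effective_class e}"
  shows "m_complete_within (Pi0 3) {e \<in> L. vc_dim (concept_class e) = \<infinity>} L \<and>
         in_class_within (Sigma0 3) {e \<in> L. vc_dim (concept_class e) \<noteq> \<infinity>} L"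
proof -
  obtain R where R: "R \<in> Pi0 3"
      "\<And>e. weakly_effective_class e \<Longrightarrow> e \<in> R \<longleftrightarrow> vc_dim (concept_class e) = \<infinity>"
    using infinite_vc_dim_Pi0_3 by blast
  have weak: "weakly_effective_class e" if "e \<in> L" for e
    using that unfolding assms effective_class_def by blast
  have inf: "{e \<in> L. vc_dim (concept_class e) = \<infinity>} = R \<inter> L"
    and fin: "{e \<in> L. vc_dim (concept_class e) \<noteq> \<infinity>} = - R \<inter> L"
    using R(2) weak by auto
  \<comment> \<open>The complement of the same \<open>R\<close> gives the second claim.\<close>
  have "- R \<in> Sigma0 3" using R(1) unfolding Pi0_def by blast
  moreover have "m_reducible_within S {e \<in> L. vc_dim (concept_class e) = \<infinity>} L" if "S \<in> Pi0 3" for S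
    using infinite_vc_dim_hard[OF that] unfolding m_reducible_within_def assms by blast
  ultimately show ?thesis
    using R(1) fin inf unfolding m_complete_within_def in_class_within_def by blast
qed

end
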